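(* For $k\ge 0$ let $\{P_j^{m}(W^{(2k)};s,t): 0\le j\le \lfloor m/2\rfloor\}$ denote an orthogonal basis of $\mathcal V_m^{E}(W^{(2k)},\Omega)$, and let $\{Y_\ell^k:1\le \ell\le \dim\mathcal H_k^d\}$ be an orthonormal basis of $\mathcal H_k^d$. Define $$\mathbf Q_{j,k,\ell}^n(x,t)=P_j^{n-k}\big(W^{(2k)};\|x\|,t\big)\,Y_\ell^k(x).$$ Then $\{\mathbf Q_{j,k,\ell}^n: 1\le \ell\le\dim\mathcal H_k^d,\ 0\le j\le\lfloor\frac{n-k}{2}\rfloor,\ 0\le k\le n\}$ is an orthogonal basis of $\mathcal V_n(\mathbf W,\mathbb V^{d+1})$, where $\mathbf W(x,t)=W(\|x\|,t)$. Moreover, $$\mathbf H_{j,k}^n:=\langle \mathbf Q_{j,k,\ell}^n,\mathbf Q_{j,k,\ell}^n\rangle_{\mathbf W}=\big\langle P_j^{n-k}(W^{(2k)}),P_j^{n-k}(W^{(2k)})\big\rangle_{W^{(2k)}}=:\mathsf H_{j,k}^{n-k}.$$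
   Context: Let $\Omega\subset\mathbb R^2$ be a domain with $(s,t)\in\Omega\iff(-s,t)\in\Omega$; put $\Omega_+=\{(s,t)\in\Omega:s\ge0\}$. Let $W$ be a weight function on $\Omega$: nonnegative, even in $s$ ($W(-s,t)=W(s,t)$), with finite moments. For $k\ge0$ set $W^{(k)}(s,t)=|s|^{k+d-1}W(s,t)$, so $W^{(2k)}(s,t)=|s|^{2k+d-1}W(s,t)$. The domain of revolution is $\mathbb V^{d+1}=\{(x,t):x\in\mathbb R^d,\ t\in\mathbb R,\ (\|x\|,t)\in\Omega_+\}$. The inner products are $\langle f,g\rangle_{\mathbf W}=\int_{\mathbb V^{d+1}}f\,g\,\mathbf W\,dx\,dt$ and, for a weight $U$ on $\Omega$, $\langle f,g\rangle_{U}=\int_\Omega f\,g\,U\,ds\,dt$. For a weight $U$ on a domain $D$, $\mathcal V_n(U,D)$ is the space of orthogonal polynomials of total degree $n$: polynomials of degree at most $n$ orthogonal in $L^2(U,D)$ to all polynomials of degree $<n$. $\mathcal V_m^E(W^{(2k)},\Omega)$ is the subspace of those $P\in\mathcal V_m(W^{(2k)},\Omega)$ with $P(s,t)=P(-s,t)$. $\mathcal H_k^d$ is the space of homogeneous harmonic polynomials of degree $k$ in $d$ variables (spherical harmonics when restricted to the unit sphere $\mathbb S^{d-1}$); orthonormal means with respect to $\frac1{\omega_d}\int_{\mathbb S^{d-1}}fg\,d\sigma$, where $\omega_d$ is the surface area of $\mathbb S^{d-1}$. $Y_\ell^k(x)$ is regarded as a homogeneous polynomial on $\mathbb R^d$.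
   Formalization: With the unnormalized inner products given, the norm identity is false as printed (d=2, unit disk, W=1, n=0: 4π/3 versus 4/3); what is proved is H_{j,k}^n = (ω_d/2) times the squared norm of P_j^{n-k} in W^{(2k)}, ω_d being the area of the unit sphere. *)

theory Defs
  imports "HOL-Analysis.Analysis" "HOL-Library.Function_Algebras"
begin

text \<open>Real-valued functions on a set form a real vector space under the pointwise operations, so
  that the library notions of span, independence and dimension apply to spaces of polynomials.\<close>

instantiation "fun" :: (type, real_vector) real_vector
begin

definition scaleR_fun :: "real \<Rightarrow> ('a \<Rightarrow> 'b) \<Rightarrow> 'a \<Rightarrow> 'b" where
  "scaleR_fun c f = (\<lambda>x. c *\<^sub>R f x)"

instance
  by standard (simp_all add: scaleR_fun_def plus_fun_def fun_eq_iff scaleR_add_right scaleR_add_left)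

end

section \<open>Polynomials in the coordinates of a Euclidean space\<close>

text \<open>Polynomials are represented by the functions they define on the whole space. The exponent
  of the coordinate along the basis vector \<open>b\<close> is \<open>\<alpha> b\<close>; the values of \<open>\<alpha>\<close> off \<open>Basis\<close> are
  irrelevant. For \<open>real \<times> real\<close> the monomials are the functions \<open>s ^ a * t ^ b\<close>.\<close>

definition monomial :: "('a::euclidean_space \<Rightarrow> nat) \<Rightarrow> 'a \<Rightarrow> real" where
  "monomial \<alpha> x = (\<Prod>b\<in>Basis. (x \<bullet> b) ^ \<alpha> b)"

definition polys_degree_le :: "nat \<Rightarrow> ('a::euclidean_space \<Rightarrow> real) set" where
  "polys_degree_le n = span {monomial \<alpha> |\<alpha>. (\<Sum>b\<in>Basis. \<alpha> b) \<le> n}"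

definition homogeneous_polys :: "nat \<Rightarrow> ('a::euclidean_space \<Rightarrow> real) set" where
  "homogeneous_polys k = span {monomial \<alpha> |\<alpha>. (\<Sum>b\<in>Basis. \<alpha> b) = k}"

definition laplacian :: "('a::euclidean_space \<Rightarrow> real) \<Rightarrow> 'a \<Rightarrow> real" where
  "laplacian f x = (\<Sum>b\<in>Basis. (deriv ^^ 2) (\<lambda>h. f (x + h *\<^sub>R b)) 0)"

definition harmonics :: "nat \<Rightarrow> ('a::euclidean_space \<Rightarrow> real) set" where
  "harmonics k = {Y \<in> homogeneous_polys k. \<forall>x. laplacian Y x = 0}"

section \<open>Inner products and orthogonal bases\<close>

definition weighted_inner ::
    "('a::euclidean_space \<Rightarrow> real) \<Rightarrow> 'a set \<Rightarrow> ('a \<Rightarrow> real) \<Rightarrow> ('a \<Rightarrow> real) \<Rightarrow> real" where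
  "weighted_inner U D f g = (LINT z:D|lebesgue. f z * g z * U z)"

text \<open>Surface measure \<open>\<sigma>\<close> of the unit sphere, regarded as a measure on the whole space:
  \<open>\<sigma> A\<close> is \<open>DIM('a)\<close> times the volume of the cone \<open>{r *\<^sub>R \<xi> |r \<xi>. 0 < r \<and> r < 1 \<and> \<xi> \<in> A}\<close>,
  so that integration in polar coordinates carries the density \<open>r ^ (DIM('a) - 1)\<close>.
  In dimension one this is the counting measure on \<open>{-1, 1}\<close>.\<close>

definition surface_measure :: "'a::euclidean_space measure" where
  "surface_measure =
     distr (density lborel (\<lambda>x. ennreal (real DIM('a)) * indicator (ball 0 1) x)) borel sgn"

definition sphere_area :: "'a::euclidean_space itself \<Rightarrow> real" where
  "sphere_area _ = measure (surface_measure :: 'a measure) (sphere 0 1)"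

definition sphere_inner ::
    "('a::euclidean_space \<Rightarrow> real) \<Rightarrow> ('a \<Rightarrow> real) \<Rightarrow> real" where
  "sphere_inner f g =
     1 / sphere_area TYPE('a) * (LINT \<xi>:sphere 0 1|surface_measure. f \<xi> * g \<xi>)"

definition orthogonal_basis ::
    "(('a \<Rightarrow> real) \<Rightarrow> ('a \<Rightarrow> real) \<Rightarrow> real) \<Rightarrow> ('a \<Rightarrow> real) set \<Rightarrow> 'i set \<Rightarrow> ('i \<Rightarrow> 'a \<Rightarrow> real) \<Rightarrow> bool"
  where
  "orthogonal_basis ip V I q \<longleftrightarrow>
     inj_on q I \<and> independent (q ` I) \<and> span (q ` I) = V \<and>
     (\<forall>i\<in>I. \<forall>j\<in>I. i \<noteq> j \<longrightarrow> ip (q i) (q j) = 0)"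

definition orthonormal_basis ::
    "(('a \<Rightarrow> real) \<Rightarrow> ('a \<Rightarrow> real) \<Rightarrow> real) \<Rightarrow> ('a \<Rightarrow> real) set \<Rightarrow> 'i set \<Rightarrow> ('i \<Rightarrow> 'a \<Rightarrow> real) \<Rightarrow> bool"
  where
  "orthonormal_basis ip V I q \<longleftrightarrow>
     orthogonal_basis ip V I q \<and> (\<forall>i\<in>I. ip (q i) (q i) = 1)"

section \<open>Orthogonal polynomials\<close>

definition orth_polys ::
    "nat \<Rightarrow> ('a::euclidean_space \<Rightarrow> real) \<Rightarrow> 'a set \<Rightarrow> ('a \<Rightarrow> real) set" where
  "orth_polys n U D =
     {p \<in> polys_degree_le n. \<forall>m<n. \<forall>q\<in>polys_degree_le m. weighted_inner U D p q = 0}"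

definition even_orth_polys ::
    "nat \<Rightarrow> (real \<times> real \<Rightarrow> real) \<Rightarrow> (real \<times> real) set \<Rightarrow> (real \<times> real \<Rightarrow> real) set" where
  "even_orth_polys m U D = {p \<in> orth_polys m U D. \<forall>s t. p (s, t) = p (- s, t)}"

section \<open>Domains of revolution\<close>

text \<open>The weight \<open>W\<close> extended by \<open>0\<close> off \<open>\<Omega>\<close> is Lebesgue measurable by the
  moment condition for \<open>a = b = 0\<close>.\<close>

definition even_weight :: "(real \<times> real \<Rightarrow> real) \<Rightarrow> (real \<times> real) set \<Rightarrow> bool" where
  "even_weight W \<Omega> \<longleftrightarrow>
     (\<forall>s t. (s, t) \<in> \<Omega> \<longrightarrow> W (s, t) \<ge> 0 \<and> W (- s, t) = W (s, t)) \<and>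
     (\<forall>a b :: nat. set_integrable lebesgue \<Omega> (\<lambda>(s, t). s ^ a * t ^ b * W (s, t)))"

definition lifted_weight ::
    "nat \<Rightarrow> (real \<times> real \<Rightarrow> real) \<Rightarrow> nat \<Rightarrow> real \<times> real \<Rightarrow> real" where
  "lifted_weight d W k = (\<lambda>(s, t). \<bar>s\<bar> ^ (k + d - 1) * W (s, t))"

definition right_half :: "(real \<times> real) set \<Rightarrow> (real \<times> real) set" where
  "right_half \<Omega> = {(s, t) \<in> \<Omega>. s \<ge> 0}"

definition revolution_domain :: "(real \<times> real) set \<Rightarrow> ((real ^ 'd) \<times> real) set" where
  "revolution_domain \<Omega> = {(x, t). (norm x, t) \<in> right_half \<Omega>}"

definition revolution_weight :: "(real \<times> real \<Rightarrow> real) \<Rightarrow> (real ^ 'd) \<times> real \<Rightarrow> real" where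
  "revolution_weight W = (\<lambda>(x, t). W (norm x, t))"

text \<open>\<open>P k m j\<close> stands for \<open>P\<^sub>j\<^sup>m(W\<^bsup>(2k)\<^esup>)\<close> and \<open>Y k l\<close> for \<open>Y\<^sub>l\<^sup>k\<close>.
  Neither \<open>weighted_inner\<close> on \<open>\<Omega>\<close> nor the one on the domain of revolution is normalized,
  whereas \<open>sphere_inner\<close> is. Polar coordinates therefore contribute the total area of the sphere,
  and passing from the right half of \<open>\<Omega>\<close> to \<open>\<Omega>\<close> halves the integral: the squared norm of a
  \<open>revolution_poly\<close> is \<open>sphere_area / 2\<close> times the squared norm of its factor \<open>P k (n - k) j\<close>.\<close>

definition revolution_poly ::
    "(nat \<Rightarrow> nat \<Rightarrow> nat \<Rightarrow> real \<times> real \<Rightarrow> real) \<Rightarrow> (nat \<Rightarrow> nat \<Rightarrow> real ^ 'd \<Rightarrow> real) \<Rightarrow>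
     nat \<Rightarrow> nat \<times> nat \<times> nat \<Rightarrow> (real ^ 'd) \<times> real \<Rightarrow> real" where
  "revolution_poly P Y n = (\<lambda>(j, k, l) (x, t). P k (n - k) j (norm x, t) * Y k l x)"

end

theory Submission
  imports Defs "HOL-Probability.Probability" "HOL-Computational_Algebra.Polynomial"
begin

text \<open>In polar coordinates the inner product of \<open>p (\<parallel>x\<parallel>, t) Y (x)\<close> and \<open>q (\<parallel>x\<parallel>, t) Z (x)\<close>, with \<open>Y\<close>, \<open>Z\<close>
  homogeneous of degrees \<open>k\<close>, \<open>k'\<close>, is an integral of \<open>p q\<close> over the right half of the plane domain times the
  integral of \<open>Y Z\<close> over the sphere. Spherical harmonics of different degrees are orthogonal, and for
  \<open>k = k'\<close> the radial factor is half of an inner product with respect to the lifted weight; hence the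
  products are mutually orthogonal. They span: a homogeneous polynomial of degree \<open>a\<close> is a sum of terms
  \<open>\<parallel>x\<parallel>\<^sup>2\<^sup>i Z\<^sub>i (x)\<close> with \<open>Z\<^sub>i\<close> harmonic of degree \<open>a - 2 i\<close>, and \<open>s\<^sup>2\<^sup>i t\<^sup>b\<close> is even in \<open>s\<close>, hence a combination of
  the given even orthogonal polynomials of degrees at most \<open>2 i + b\<close>. Since the squared norms are nonzero,
  an element of the space of orthogonal polynomials of degree \<open>n\<close> has no component of lower degree.

  The squared norms in the plane vanish only for a weight that is zero almost everywhere. That case
  is excluded by the hypothesis on the bases: the even polynomials of degree one would contain both \<open>1\<close> and \<open>t\<close>,
  whereas the given basis of degree one has a single element.\<close>

section \<open>Polynomials\<close>

text \<open>Orthogonality of spherical harmonics is classically read off from Green's formula on the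
  ball. Here a Gaussian weight on the whole space replaces the sphere: its integrals of monomials
  factor over the coordinates, integration by parts has no boundary term and reduces to a recursion
  for one-dimensional moments, and for a homogeneous integrand polar coordinates turn the result
  into a nonzero multiple of the surface integral. The weight is only Lebesgue measurable, so
  composing it with \<open>(norm x, t)\<close> is delicate; the cylindrical formula is proved for a
  Borel representative and carried over by showing that null sets of the half plane pull back to
  null sets. The same formula in dimension one, where the sphere is \<open>{-1, 1}\<close>, yields
  the parity rules for integrals over the plane. Linear independence is a consequence of
  orthogonality and nonzero squared norms, with no count of dimensions.\<close>

lemma fun_sum_apply: "(\<Sum>i\<in>A. f i) x = (\<Sum>i\<in>A. f i x)"
  by (induction A rule: infinite_finite_induct) (auto simp: zero_fun_def)

lemma fun_add_in_span: "f \<in> span S \<Longrightarrow> g \<in> span S \<Longrightarrow> (\<lambda>x. f x + g x) \<in> span S"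
  for f g :: "'a \<Rightarrow> real"
  using span_add[of f S g] by (simp add: plus_fun_def)

lemma fun_scale_in_span: "f \<in> span S \<Longrightarrow> (\<lambda>x. c * f x) \<in> span S" for f :: "'a \<Rightarrow> real"
  using span_scale[of f S c] by (simp add: scaleR_fun_def)

lemma fun_zero_in_span: "(\<lambda>x. 0) \<in> span S" for S :: "('a \<Rightarrow> real) set"
  using span_zero[of S] by (simp add: zero_fun_def)

lemma fun_sum_in_span:
  fixes f :: "'i \<Rightarrow> 'a \<Rightarrow> real"
  shows "(\<And>i. i \<in> A \<Longrightarrow> f i \<in> span S) \<Longrightarrow> (\<lambda>x. \<Sum>i\<in>A. f i x) \<in> span S"
  using span_sum[of A f S] by (simp add: fun_sum_apply[abs_def])

lemma fun_diff_in_span: "f \<in> span S \<Longrightarrow> g \<in> span S \<Longrightarrow> (\<lambda>x. f x - g x) \<in> span S"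
  for f g :: "'a \<Rightarrow> real"
  using span_diff[of f S g] by (simp add: fun_diff_def)

lemma fun_subspaceI:
  fixes V :: "('a \<Rightarrow> real) set"
  assumes "(\<lambda>x. 0) \<in> V" "\<And>f g. f \<in> V \<Longrightarrow> g \<in> V \<Longrightarrow> (\<lambda>x. f x + g x) \<in> V"
    "\<And>c f. f \<in> V \<Longrightarrow> (\<lambda>x. c * f x) \<in> V"
  shows "subspace V"
  using assms by (auto simp: subspace_def zero_fun_def plus_fun_def scaleR_fun_def)

text \<open>The members of \<open>span S\<close> with property \<open>Q\<close> form a subspace
  containing \<open>S\<close>. Membership in the span is handed to the \<open>add\<close> and
  \<open>scale\<close> cases because additivity of derivatives and integrals is available only
  inside the space in question.\<close>

lemma fun_span_induct [consumes 1, case_names base zero add scale]: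
  fixes f :: "'a \<Rightarrow> real"
  assumes "f \<in> span S" "\<And>f. f \<in> S \<Longrightarrow> Q f" "Q (\<lambda>x. 0)"
    "\<And>f g. f \<in> span S \<Longrightarrow> g \<in> span S \<Longrightarrow> Q f \<Longrightarrow> Q g \<Longrightarrow> Q (\<lambda>x. f x + g x)"
    "\<And>c f. f \<in> span S \<Longrightarrow> Q f \<Longrightarrow> Q (\<lambda>x. c * f x)"
  shows "Q f"
proof -
  have "subspace {f \<in> span S. Q f}"
    using assms by (intro fun_subspaceI)
      (auto intro: fun_add_in_span fun_zero_in_span fun_scale_in_span)
  then have "f \<in> {f \<in> span S. Q f}"
    using assms(1) assms(2) by (intro span_induct[of f S "\<lambda>f. f \<in> {f \<in> span S. Q f}"]) (auto intro: span_base)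
  then show ?thesis by simp
qed

text \<open>Multiplication is bilinear, so one induction per factor reduces the claim to generators.
  These are monomials in the degree bounds, and radial and spherical basis functions in the final
  spanning argument.\<close>

lemma span_mult:
  fixes p q :: "'a \<Rightarrow> real"
  assumes p: "p \<in> span A" and q: "q \<in> span B"
    and AB: "\<And>a b. a \<in> A \<Longrightarrow> b \<in> B \<Longrightarrow> (\<lambda>x. a x * b x) \<in> span C"
  shows "(\<lambda>x. p x * q x) \<in> span C"
  using p
proof (induction rule: fun_span_induct)
  case (base a)
  show ?case
    using q
  proof (induction rule: fun_span_induct)
    case (add f g)
    from fun_add_in_span[OF add(3,4)] show ?case by (simp add: algebra_simps)
  next
    case (scale c f)
    from fun_scale_in_span[OF scale(2), of c] show ?case by (simp add: algebra_simps)
  qed (use base AB in \<open>auto intro: fun_zero_in_span\<close>)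
next
  case (add f g)
  from fun_add_in_span[OF add(3,4)] show ?case by (simp add: algebra_simps)
next
  case (scale c f)
  from fun_scale_in_span[OF scale(2), of c] show ?case by (simp add: algebra_simps)
qed (auto intro: fun_zero_in_span)

section \<open>Degree and homogeneity of polynomials\<close>

lemma monomial_mult: "monomial \<alpha> x * monomial \<beta> x = monomial (\<lambda>b. \<alpha> b + \<beta> b) x"
  by (simp add: monomial_def power_add prod.distrib)

lemma monomial_homogeneous: "monomial \<alpha> \<in> homogeneous_polys (\<Sum>b\<in>Basis. \<alpha> b)"
  unfolding homogeneous_polys_def by (rule span_base) auto

lemma monomial_degree_le: "(\<Sum>b\<in>Basis. \<alpha> b) \<le> n \<Longrightarrow> monomial \<alpha> \<in> polys_degree_le n"
  unfolding polys_degree_le_def by (rule span_base) auto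

lemma homogeneous_mult:
  assumes "p \<in> homogeneous_polys m" "q \<in> homogeneous_polys n"
  shows "(\<lambda>x. p x * q x) \<in> homogeneous_polys (m + n)"
  using assms(1,2)[unfolded homogeneous_polys_def] unfolding homogeneous_polys_def
  by (rule span_mult) (auto simp: monomial_mult sum.distrib intro!: span_base)

lemma degree_le_mult:
  assumes "p \<in> polys_degree_le m" "q \<in> polys_degree_le n"
  shows "(\<lambda>x. p x * q x) \<in> polys_degree_le (m + n)"
  using assms(1,2)[unfolded polys_degree_le_def] unfolding polys_degree_le_def
  by (rule span_mult) (auto simp: monomial_mult sum.distrib intro!: span_base)

lemma degree_le_mono: "m \<le> n \<Longrightarrow> polys_degree_le m \<subseteq> polys_degree_le n"
  unfolding polys_degree_le_def by (rule span_mono) auto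

lemma homogeneous_degree_le: "homogeneous_polys n \<subseteq> polys_degree_le n"
  unfolding polys_degree_le_def homogeneous_polys_def by (rule span_mono) auto

lemma homogeneous_scaleR:
  assumes "p \<in> homogeneous_polys k"
  shows "p (c *\<^sub>R x) = c ^ k * p x"
  using assms unfolding homogeneous_polys_def
proof (induction rule: fun_span_induct)
  case (base f)
  then show ?case
    by (auto simp: monomial_def power_mult_distrib prod.distrib power_sum)
qed (auto simp: algebra_simps)

lemma continuous_on_degree_le:
  assumes "p \<in> polys_degree_le k"
  shows "continuous_on A p"
  using assms unfolding polys_degree_le_def
proof (induction rule: fun_span_induct)
  case (base f)
  then show ?case
    by (auto simp: monomial_def[abs_def] intro!: continuous_intros)
qed (auto intro!: continuous_intros)

lemma const_homogeneous: "(\<lambda>x::'a::euclidean_space. c) \<in> homogeneous_polys 0"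
proof -
  have "(monomial (\<lambda>_. 0) :: 'a \<Rightarrow> real) \<in> homogeneous_polys 0"
    using monomial_homogeneous[of "\<lambda>_::'a. 0"] by simp
  then show ?thesis
    using fun_scale_in_span[of "monomial (\<lambda>_. 0)" _ c]
    by (simp add: monomial_def homogeneous_polys_def)
qed

lemma coord_homogeneous: "b \<in> Basis \<Longrightarrow> (\<lambda>x. x \<bullet> b) \<in> homogeneous_polys 1"
  using monomial_homogeneous[of "\<lambda>c. if c = b then 1 else 0"]
  by (simp add: monomial_def[abs_def] if_distrib[of "\<lambda>n. _ ^ n"] cong: if_cong)

lemma norm_square_sum: "(norm x)\<^sup>2 = (\<Sum>b\<in>Basis. (x \<bullet> b) * (x \<bullet> b))"
  unfolding power2_norm_eq_inner by (rule euclidean_inner)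

lemma norm_square_homogeneous: "(\<lambda>x. (norm x)\<^sup>2) \<in> homogeneous_polys 2"
  unfolding norm_square_sum homogeneous_polys_def
proof (rule fun_sum_in_span)
  fix b :: 'a assume "b \<in> Basis"
  from homogeneous_mult[OF coord_homogeneous coord_homogeneous, OF this this]
  show "(\<lambda>x. (x \<bullet> b) * (x \<bullet> b)) \<in> span {monomial \<alpha> |\<alpha>. sum \<alpha> Basis = 2}"
    by (simp add: homogeneous_polys_def numeral_2_eq_2)
qed

lemma norm_power_homogeneous: "(\<lambda>x. (norm x) ^ (2 * i)) \<in> homogeneous_polys (2 * i)"
proof (induction i)
  case 0
  then show ?case by (simp add: const_homogeneous)
next
  case (Suc i)
  from homogeneous_mult[OF norm_square_homogeneous Suc] show ?case
    by (simp add: power2_eq_square mult.assoc)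
qed

section \<open>Harmonic decomposition\<close>

definition partial_deriv :: "'a::euclidean_space \<Rightarrow> ('a \<Rightarrow> real) \<Rightarrow> 'a \<Rightarrow> real" where
  "partial_deriv b p x = deriv (\<lambda>h. p (x + h *\<^sub>R b)) 0"

lemma monomial_split:
  "b \<in> Basis \<Longrightarrow> monomial \<alpha> x = (x \<bullet> b) ^ \<alpha> b * (\<Prod>c\<in>Basis - {b}. (x \<bullet> c) ^ \<alpha> c)"
  unfolding monomial_def by (rule prod.remove) auto

text \<open>If \<open>\<alpha> b = 0\<close>, the truncated exponent \<open>\<alpha> b - 1\<close>
  is harmless, since the term is multiplied by \<open>\<alpha> b\<close>.\<close>

lemma monomial_partial_deriv:
  assumes b: "b \<in> Basis"
  shows "((\<lambda>h. monomial \<alpha> (x + h *\<^sub>R b)) has_real_derivative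
            \<alpha> b * monomial (\<alpha>(b := \<alpha> b - 1)) x) (at 0)"
proof -
  have "(\<Prod>c\<in>Basis - {b}. ((x + h *\<^sub>R b) \<bullet> c) ^ \<alpha> c) = (\<Prod>c\<in>Basis - {b}. (x \<bullet> c) ^ \<alpha> c)" for h
    using b by (intro prod.cong) (auto simp: inner_add_left inner_Basis)
  then have 1: "monomial \<alpha> (x + h *\<^sub>R b)
      = (x \<bullet> b + h) ^ \<alpha> b * (\<Prod>c\<in>Basis - {b}. (x \<bullet> c) ^ \<alpha> c)" for h
    using b by (simp add: monomial_split[OF b] inner_add_left)
  have 2: "(\<Prod>c\<in>Basis - {b}. (x \<bullet> c) ^ (\<alpha>(b := \<alpha> b - 1)) c) = (\<Prod>c\<in>Basis - {b}. (x \<bullet> c) ^ \<alpha> c)"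
    by (intro prod.cong) auto
  show ?thesis
    unfolding 1 monomial_split[OF b, of "\<alpha>(b := \<alpha> b - 1)"] 2
    by (auto intro!: derivative_eq_intros)
qed

lemma sum_decrement:
  assumes "b \<in> Basis" "(\<alpha>::'a::euclidean_space \<Rightarrow> nat) b \<noteq> 0"
  shows "(\<Sum>c\<in>Basis. (\<alpha>(b := \<alpha> b - 1)) c) = (\<Sum>c\<in>Basis. \<alpha> c) - 1"
proof -
  have "(\<Sum>c\<in>Basis - {b}. (\<alpha>(b := \<alpha> b - 1)) c) = (\<Sum>c\<in>Basis - {b}. \<alpha> c)"
    by (intro sum.cong) auto
  then show ?thesis
    using assms by (simp add: sum.remove[of Basis b])
qed

text \<open>Differentiability along \<open>b\<close> and the degree of the derivative are carried
  through one induction. For \<open>k = 0\<close> the truncated degree \<open>k - 1\<close> is again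
  \<open>0\<close>; the derivative is then the zero function, which lies in every space of
  homogeneous polynomials.\<close>

lemma homogeneous_has_partial_deriv:
  assumes p: "p \<in> homogeneous_polys k" and b: "b \<in> Basis"
  shows "\<exists>q\<in>homogeneous_polys (k - 1).
           \<forall>x. ((\<lambda>h. p (x + h *\<^sub>R b)) has_real_derivative q x) (at 0)"
  using p unfolding homogeneous_polys_def[of k]
proof (induction rule: fun_span_induct)
  case (base f)
  then obtain \<alpha> where f: "f = monomial \<alpha>" "(\<Sum>b\<in>Basis. \<alpha> b) = k" by auto
  have "(\<lambda>x. \<alpha> b * monomial (\<alpha>(b := \<alpha> b - 1)) x) \<in> homogeneous_polys (k - 1)"
  proof (cases "\<alpha> b = 0")
    case True
    then show ?thesis by (simp add: homogeneous_polys_def fun_zero_in_span)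
  next
    case False
    then show ?thesis
      using monomial_homogeneous[of "\<alpha>(b := \<alpha> b - 1)"] sum_decrement[OF b, of \<alpha>] f
      by (auto simp: homogeneous_polys_def intro: fun_scale_in_span)
  qed
  moreover have "\<forall>x. ((\<lambda>h. f (x + h *\<^sub>R b)) has_real_derivative \<alpha> b * monomial (\<alpha>(b := \<alpha> b - 1)) x) (at 0)"
    using f monomial_partial_deriv[OF b, of \<alpha>] by simp
  ultimately show ?case by (intro bexI[of _ "\<lambda>x. \<alpha> b * monomial (\<alpha>(b := \<alpha> b - 1)) x"])
next
  case zero
  show ?case by (rule bexI[of _ "\<lambda>x. 0"]) (auto simp: homogeneous_polys_def fun_zero_in_span)
next
  case (add f g)
  then obtain q r where "q \<in> homogeneous_polys (k - 1)" "r \<in> homogeneous_polys (k - 1)"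
    "\<forall>x. ((\<lambda>h. f (x + h *\<^sub>R b)) has_real_derivative q x) (at 0)"
    "\<forall>x. ((\<lambda>h. g (x + h *\<^sub>R b)) has_real_derivative r x) (at 0)" by blast
  then show ?case
    by (intro bexI[of _ "\<lambda>x. q x + r x"])
       (auto simp: homogeneous_polys_def intro: fun_add_in_span intro!: derivative_intros)
next
  case (scale c f)
  then obtain q where "q \<in> homogeneous_polys (k - 1)"
    "\<forall>x. ((\<lambda>h. f (x + h *\<^sub>R b)) has_real_derivative q x) (at 0)" by blast
  then show ?case
    by (intro bexI[of _ "\<lambda>x. c * q x"])
       (auto simp: homogeneous_polys_def intro: fun_scale_in_span intro!: DERIV_cmult)
qed

lemma
  assumes "p \<in> homogeneous_polys k" "b \<in> Basis"
  shows partial_deriv_homogeneous: "partial_deriv b p \<in> homogeneous_polys (k - 1)"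
    and has_partial_deriv: "((\<lambda>h. p (x + h *\<^sub>R b)) has_real_derivative partial_deriv b p x) (at 0)"
proof -
  obtain q where q: "q \<in> homogeneous_polys (k - 1)"
    "\<And>x. ((\<lambda>h. p (x + h *\<^sub>R b)) has_real_derivative q x) (at 0)"
    using homogeneous_has_partial_deriv[OF assms] by blast
  have "partial_deriv b p = q"
    using DERIV_imp_deriv[OF q(2)] by (auto simp: partial_deriv_def)
  with q show "partial_deriv b p \<in> homogeneous_polys (k - 1)"
    "((\<lambda>h. p (x + h *\<^sub>R b)) has_real_derivative partial_deriv b p x) (at 0)" by auto
qed

text \<open>The iterated \<open>deriv\<close> in \<open>laplacian\<close> needs the first derivative
  along the whole line through \<open>x\<close>, not only at \<open>h = 0\<close>; translation of
  the base point provides it.\<close>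

lemma has_partial_deriv_at:
  assumes "p \<in> homogeneous_polys k" "b \<in> Basis"
  shows "((\<lambda>h. p (x + h *\<^sub>R b)) has_real_derivative partial_deriv b p (x + h *\<^sub>R b)) (at h)"
  using has_partial_deriv[OF assms, of "x + h *\<^sub>R b"] DERIV_shift[of "\<lambda>h. p (x + h *\<^sub>R b)" _ 0 h]
  by (simp add: algebra_simps)

lemma laplacian_partial_deriv:
  assumes "p \<in> homogeneous_polys k"
  shows "laplacian p x = (\<Sum>b\<in>Basis. partial_deriv b (partial_deriv b p) x)"
  unfolding laplacian_def
proof (rule sum.cong)
  fix b :: 'a assume b: "b \<in> Basis"
  have "deriv (\<lambda>h. p (x + h *\<^sub>R b)) = (\<lambda>h. partial_deriv b p (x + h *\<^sub>R b))"
    using has_partial_deriv_at[OF assms b] by (auto intro!: DERIV_imp_deriv)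
  then show "(deriv ^^ 2) (\<lambda>h. p (x + h *\<^sub>R b)) 0 = partial_deriv b (partial_deriv b p) x"
    by (simp add: numeral_2_eq_2 partial_deriv_def)
qed simp

lemma partial_deriv_add:
  assumes "p \<in> homogeneous_polys k" "q \<in> homogeneous_polys m" "b \<in> Basis"
  shows "partial_deriv b (\<lambda>x. p x + q x) x = partial_deriv b p x + partial_deriv b q x"
  unfolding partial_deriv_def[of b "\<lambda>x. p x + q x"]
  by (intro DERIV_imp_deriv DERIV_add has_partial_deriv[OF assms(1,3)] has_partial_deriv[OF assms(2,3)])

lemma partial_deriv_cmult:
  assumes "p \<in> homogeneous_polys k" "b \<in> Basis"
  shows "partial_deriv b (\<lambda>x. c * p x) x = c * partial_deriv b p x"
  unfolding partial_deriv_def[of b "\<lambda>x. c * p x"]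
  by (intro DERIV_imp_deriv DERIV_cmult has_partial_deriv[OF assms])

lemma partial_deriv_mult:
  assumes "p \<in> homogeneous_polys k" "q \<in> homogeneous_polys m" "b \<in> Basis"
  shows "partial_deriv b (\<lambda>x. p x * q x) x = partial_deriv b p x * q x + p x * partial_deriv b q x"
proof -
  have "((\<lambda>h. p (x + h *\<^sub>R b) * q (x + h *\<^sub>R b)) has_real_derivative
      partial_deriv b p x * q x + p x * partial_deriv b q x) (at 0)"
    using DERIV_mult[OF has_partial_deriv[OF assms(1,3), of x] has_partial_deriv[OF assms(2,3), of x]]
    by (simp add: algebra_simps)
  then show ?thesis
    unfolding partial_deriv_def[of b "\<lambda>x. p x * q x"] by (rule DERIV_imp_deriv)
qed

lemma partial_deriv_monomial:
  "b \<in> Basis \<Longrightarrow> partial_deriv b (monomial \<alpha>) x = \<alpha> b * monomial (\<alpha>(b := \<alpha> b - 1)) x"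
  unfolding partial_deriv_def by (intro DERIV_imp_deriv monomial_partial_deriv)

lemma partial_deriv_const: "partial_deriv b (\<lambda>x. c) x = 0"
  by (simp add: partial_deriv_def)

lemma coord_monomial_decrement:
  assumes "b \<in> Basis"
  shows "(x \<bullet> b) * (real (\<alpha> b) * monomial (\<alpha>(b := \<alpha> b - 1)) x) = \<alpha> b * monomial \<alpha> x"
proof -
  have "(\<Prod>c\<in>Basis - {b}. (x \<bullet> c) ^ (\<alpha>(b := \<alpha> b - 1)) c) = (\<Prod>c\<in>Basis - {b}. (x \<bullet> c) ^ \<alpha> c)"
    by (intro prod.cong) auto
  then show ?thesis
    unfolding monomial_split[OF assms]
    by (cases "\<alpha> b") auto
qed

text \<open>On a monomial, \<open>x \<bullet> b\<close> times the partial derivative multiplies by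
  the exponent \<open>\<alpha> b\<close>, and the exponents add up to \<open>k\<close>.\<close>

lemma euler_identity:
  assumes "p \<in> homogeneous_polys k"
  shows "(\<Sum>b\<in>Basis. (x \<bullet> b) * partial_deriv b p x) = real k * p x"
  using assms unfolding homogeneous_polys_def
proof (induction rule: fun_span_induct)
  case (base f)
  then show ?case
    by (auto simp: partial_deriv_monomial coord_monomial_decrement sum_distrib_right
        simp del: One_nat_def)
next
  case (add f g)
  then have "f \<in> homogeneous_polys k" "g \<in> homogeneous_polys k"
    by (auto simp: homogeneous_polys_def)
  with add show ?case
    by (simp add: partial_deriv_add algebra_simps sum.distrib)
next
  case (scale c f)
  then have "f \<in> homogeneous_polys k"
    by (auto simp: homogeneous_polys_def)
  with scale show ?case
    by (simp add: partial_deriv_cmult mult.left_commute[of _ c] flip: sum_distrib_left)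
qed (simp add: partial_deriv_const)

section \<open>The Laplacian on homogeneous polynomials\<close>

lemma laplacian_add:
  assumes "p \<in> homogeneous_polys k" "q \<in> homogeneous_polys k"
  shows "laplacian (\<lambda>x. p x + q x) x = laplacian p x + laplacian q x"
proof -
  have pq: "(\<lambda>x. p x + q x) \<in> homogeneous_polys k"
    using assms by (auto simp: homogeneous_polys_def intro: fun_add_in_span)
  have "partial_deriv b (\<lambda>x. p x + q x) = (\<lambda>x. partial_deriv b p x + partial_deriv b q x)"
    if "b \<in> Basis" for b
    using partial_deriv_add[OF assms that] by blast
  then show ?thesis
    using assms by (simp add: laplacian_partial_deriv[OF pq] laplacian_partial_deriv[of _ k]
        partial_deriv_add[OF partial_deriv_homogeneous partial_deriv_homogeneous] sum.distrib)
qed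

lemma laplacian_cmult:
  assumes "p \<in> homogeneous_polys k"
  shows "laplacian (\<lambda>x. c * p x) x = c * laplacian p x"
proof -
  have pq: "(\<lambda>x. c * p x) \<in> homogeneous_polys k"
    using assms by (auto simp: homogeneous_polys_def intro: fun_scale_in_span)
  have "partial_deriv b (\<lambda>x. c * p x) = (\<lambda>x. c * partial_deriv b p x)"
    if "b \<in> Basis" for b
    using partial_deriv_cmult[OF assms that] by blast
  then show ?thesis
    using assms by (simp add: laplacian_partial_deriv[OF pq] laplacian_partial_deriv[of _ k]
        partial_deriv_cmult[OF partial_deriv_homogeneous] sum_distrib_left)
qed

lemma laplacian_homogeneous:
  assumes "p \<in> homogeneous_polys k"
  shows "laplacian p \<in> homogeneous_polys (k - 2)"
proof -
  have "laplacian p = (\<lambda>x. \<Sum>b\<in>Basis. partial_deriv b (partial_deriv b p) x)"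
    using laplacian_partial_deriv[OF assms] by auto
  moreover have "partial_deriv b (partial_deriv b p) \<in> homogeneous_polys (k - 2)" if "b \<in> Basis" for b
    using partial_deriv_homogeneous[OF partial_deriv_homogeneous, OF assms that that]
    by (simp add: numeral_2_eq_2)
  ultimately show ?thesis
    unfolding homogeneous_polys_def by (auto intro: fun_sum_in_span)
qed

lemma partial_deriv_norm_square:
  assumes "b \<in> Basis"
  shows "partial_deriv b (\<lambda>x. (norm x)\<^sup>2) x = 2 * (x \<bullet> b)"
proof -
  have "(norm (x + h *\<^sub>R b))\<^sup>2 = (norm x)\<^sup>2 + 2 * h * (x \<bullet> b) + h\<^sup>2" for h
    unfolding power2_norm_eq_inner
    using assms by (simp add: inner_add_left inner_add_right inner_commute power2_eq_square)
  then show ?thesis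
    unfolding partial_deriv_def by (auto intro!: DERIV_imp_deriv derivative_eq_intros)
qed

lemma partial_deriv_coord: "b \<in> Basis \<Longrightarrow> partial_deriv b (\<lambda>x. x \<bullet> b) x = 1"
  unfolding partial_deriv_def
  by (auto simp: inner_add_left intro!: DERIV_imp_deriv derivative_eq_intros)

text \<open>Besides the second derivative of \<open>g\<close>, each coordinate contributes
  \<open>2 * g x + 4 * ((x \<bullet> b) * partial_deriv b g x)\<close>. Summation gives
  \<open>2 * DIM('a)\<close> from the first term and, by Euler's identity, \<open>4 * m\<close> from
  the second.\<close>

lemma laplacian_norm_square_mult:
  fixes g :: "'a::euclidean_space \<Rightarrow> real"
  assumes g: "g \<in> homogeneous_polys m"
  shows "laplacian (\<lambda>x. (norm x)\<^sup>2 * g x) x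
           = (2 * real DIM('a) + 4 * real m) * g x + (norm x)\<^sup>2 * laplacian g x"
proof -
  note N = norm_square_homogeneous[where ?'a = 'a]
  have "partial_deriv b (partial_deriv b (\<lambda>x. (norm x)\<^sup>2 * g x)) x =
      2 * g x + 4 * ((x \<bullet> b) * partial_deriv b g x)
        + (norm x)\<^sup>2 * partial_deriv b (partial_deriv b g) x" if b: "b \<in> Basis" for b
  proof -
    note C = coord_homogeneous[OF b] and G = partial_deriv_homogeneous[OF g b]
    have 1: "partial_deriv b (\<lambda>x. (norm x)\<^sup>2 * g x)
        = (\<lambda>x. 2 * ((x \<bullet> b) * g x) + (norm x)\<^sup>2 * partial_deriv b g x)"
      using partial_deriv_mult[OF N g b] partial_deriv_norm_square[OF b] by auto
    have "(\<lambda>x. 2 * ((x \<bullet> b) * g x)) \<in> homogeneous_polys (1 + m)"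
      using homogeneous_mult[OF C g] by (auto simp: homogeneous_polys_def intro: fun_scale_in_span)
    from partial_deriv_add[OF this homogeneous_mult[OF N G] b, of x]
    have "partial_deriv b (partial_deriv b (\<lambda>x. (norm x)\<^sup>2 * g x)) x =
      2 * partial_deriv b (\<lambda>x. (x \<bullet> b) * g x) x + partial_deriv b (\<lambda>x. (norm x)\<^sup>2 * partial_deriv b g x) x"
      unfolding 1 partial_deriv_cmult[OF homogeneous_mult[OF C g] b] .
    then show ?thesis
      unfolding partial_deriv_mult[OF C g b] partial_deriv_mult[OF N G b]
        partial_deriv_norm_square[OF b] partial_deriv_coord[OF b]
      by simp
  qed
  then have "laplacian (\<lambda>x. (norm x)\<^sup>2 * g x) x = (\<Sum>b\<in>Basis. 2 * g x + 4 * ((x \<bullet> b) * partial_deriv b g x)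
        + (norm x)\<^sup>2 * partial_deriv b (partial_deriv b g) x)"
    unfolding laplacian_partial_deriv[OF homogeneous_mult[OF N g]] by (intro sum.cong) auto
  also have "\<dots> = 2 * real DIM('a) * g x + 4 * (real m * g x) + (norm x)\<^sup>2 * laplacian g x"
    unfolding laplacian_partial_deriv[OF g] euler_identity[OF g, symmetric]
    by (simp add: sum.distrib sum_distrib_left)
  finally show ?thesis by (simp add: algebra_simps)
qed

text \<open>Each further squared norm adds \<open>2 * DIM('a) + 4 * (2 * Suc i + m)\<close> to the
  constant. The Laplacian thus lowers the power of the norm and keeps \<open>Z\<close>, up to a
  nonzero factor, which makes explicit preimages possible.\<close>

lemma laplacian_norm_power_harmonic:
  fixes Z :: "'a::euclidean_space \<Rightarrow> real"
  assumes Z: "Z \<in> harmonics m"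
  shows "laplacian (\<lambda>x. (norm x) ^ (2 * Suc i) * Z x) x
           = 2 * real (Suc i) * (2 * real i + real DIM('a) + 2 * real m) * ((norm x) ^ (2 * i) * Z x)"
proof (induction i arbitrary: x)
  case 0
  then show ?case
    using laplacian_norm_square_mult[of Z m x] Z
    by (simp add: harmonics_def algebra_simps power2_eq_square)
next
  case (Suc i)
  have h: "(\<lambda>x. (norm x) ^ (2 * Suc i) * Z x) \<in> homogeneous_polys (2 * Suc i + m)"
    using Z by (intro homogeneous_mult norm_power_homogeneous) (auto simp: harmonics_def)
  have "(\<lambda>x. (norm x) ^ (2 * Suc (Suc i)) * Z x) = (\<lambda>x::'a. (norm x)\<^sup>2 * ((norm x) ^ (2 * Suc i) * Z x))"
    by (simp add: power2_eq_square mult_ac)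
  then show ?case
    unfolding laplacian_norm_square_mult[OF h]
    using laplacian_norm_square_mult[OF h, of x] Suc[of x] by (simp add: algebra_simps power2_eq_square)
qed

text \<open>A preimage of \<open>laplacian p\<close> under the Laplacian can be written down term by term from the
  decomposition of \<open>laplacian p\<close>; subtracting it from \<open>p\<close> leaves a harmonic polynomial.\<close>

lemma harmonic_decomposition:
  fixes p :: "'a::euclidean_space \<Rightarrow> real"
  assumes "p \<in> homogeneous_polys k"
  shows "\<exists>Z. (\<forall>i\<in>{0..k div 2}. Z i \<in> harmonics (k - 2 * i)) \<and>
             (\<forall>x. p x = (\<Sum>i=0..k div 2. (norm x) ^ (2 * i) * Z i x))"
  using assms
proof (induction k arbitrary: p rule: less_induct)
  case (less k)
  show ?case
  proof (cases "k < 2")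
    case True
    have "laplacian p x = 0" for x
    proof -
      have "partial_deriv b (partial_deriv b p) x = 0" if b: "b \<in> Basis" for b
      proof -
        have d: "partial_deriv b p \<in> homogeneous_polys 0"
          using partial_deriv_homogeneous[OF less.prems b] True by (cases k) auto
        \<comment> \<open>Scaling by \<open>0\<close> with exponent \<open>0\<close>: since
          \<open>0 ^ 0 = 1\<close>, a polynomial homogeneous of degree \<open>0\<close> is
          constant.\<close>
        have "partial_deriv b p y = partial_deriv b p 0" for y
          using homogeneous_scaleR[OF d, of 0 y] by simp
        then have "partial_deriv b p = (\<lambda>_. partial_deriv b p 0)" by blast
        then show ?thesis using partial_deriv_const by metis
      qed
      then show ?thesis unfolding laplacian_partial_deriv[OF less.prems] by simp
    qed
    with True less.prems show ?thesis
      by (intro exI[of _ "\<lambda>i. p"]) (auto simp: harmonics_def)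
  next
    case False
    define e where "e = k - 2"
    have k: "k = e + 2" using False by (simp add: e_def)
    obtain Z where "\<forall>i\<in>{0..e div 2}. Z i \<in> harmonics (e - 2 * i)"
      and "\<forall>x. laplacian p x = (\<Sum>i=0..e div 2. (norm x) ^ (2 * i) * Z i x)"
      using less.IH[of e, OF _ laplacian_homogeneous[OF less.prems, folded e_def]] k by auto
    then have Z: "\<And>i. i \<le> e div 2 \<Longrightarrow> Z i \<in> harmonics (e - 2 * i)"
      and LZ: "\<And>x. laplacian p x = (\<Sum>i=0..e div 2. (norm x) ^ (2 * i) * Z i x)" by auto
    \<comment> \<open>The factor from \<open>laplacian_norm_power_harmonic\<close> with
      \<open>m = e - 2 * i\<close>. It is nonzero because the dimension is positive, even when the
      other summands vanish.\<close>
    define c where "c i = 2 * real (Suc i) * (2 * real i + real DIM('a) + 2 * real (e - 2 * i))" for i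
    have c: "c i \<noteq> 0" for i
      using DIM_positive[where ?'a = 'a] unfolding c_def
      by (metis add_pos_nonneg add_nonneg_pos less_irrefl mult_pos_pos of_nat_0_le_iff of_nat_0_less_iff
          zero_less_Suc zero_less_numeral mult_nonneg_nonneg zero_le_numeral)
    define T where "T i = (\<lambda>x::'a. inverse (c i) * ((norm x) ^ (2 * Suc i) * Z i x))" for i
    have Th: "T i \<in> homogeneous_polys k" if "i \<le> e div 2" for i
    proof -
      have "2 * Suc i + (e - 2 * i) = k" using that k by simp
      then show ?thesis
        using homogeneous_mult[OF norm_power_homogeneous[of "Suc i"], of "Z i" "e - 2 * i"] Z[OF that]
        unfolding T_def by (auto simp: harmonics_def homogeneous_polys_def intro!: fun_scale_in_span)
    qed
    have LT: "laplacian (T i) x = (norm x) ^ (2 * i) * Z i x" if "i \<le> e div 2" for i x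
    proof -
      have h: "(\<lambda>x. (norm x) ^ (2 * Suc i) * Z i x) \<in> homogeneous_polys (2 * Suc i + (e - 2 * i))"
        using Z[OF that] by (intro homogeneous_mult norm_power_homogeneous) (auto simp: harmonics_def)
      show ?thesis
        unfolding T_def laplacian_cmult[OF h] laplacian_norm_power_harmonic[OF Z[OF that]]
        using c[of i] by (simp add: c_def field_simps)
    qed
    define q where "q = (\<lambda>x. p x + (-1) * (\<Sum>i=0..e div 2. T i x))"
    have S: "(\<lambda>x. \<Sum>i\<in>A. T i x) \<in> homogeneous_polys k" if "A \<subseteq> {0..e div 2}" for A
      using that Th unfolding homogeneous_polys_def by (intro fun_sum_in_span) auto
    have LS: "laplacian (\<lambda>x. \<Sum>i\<in>A. T i x) x = (\<Sum>i\<in>A. laplacian (T i) x)"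
      if "A \<subseteq> {0..e div 2}" for A x
    proof -
      have "finite A" using that finite_subset by blast
      from this that show ?thesis
      proof (induction A rule: finite_induct)
        case empty
        then show ?case by (simp add: laplacian_def numeral_2_eq_2)
      next
        case (insert a A)
        then show ?case using laplacian_add[OF Th S, of a A x] by simp
      qed
    qed
    have mS: "(\<lambda>x. (-1) * (\<Sum>i=0..e div 2. T i x)) \<in> homogeneous_polys k"
      using S[of "{0..e div 2}"] unfolding homogeneous_polys_def by (intro fun_scale_in_span) auto
    have qh: "q \<in> homogeneous_polys k"
      unfolding q_def using mS less.prems unfolding homogeneous_polys_def by (rule fun_add_in_span[rotated])
    have "laplacian q x = 0" for x
      unfolding q_def laplacian_add[OF less.prems mS] laplacian_cmult[OF S[OF order_refl]]
        LS[OF order_refl] LZ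
      by (simp add: LT)
    with qh have q: "q \<in> harmonics k" by (simp add: harmonics_def)
    \<comment> \<open>The preimage terms carry one more squared norm, so their indices move up by
      one and leave index \<open>0\<close> to the harmonic remainder \<open>q\<close>.\<close>
    define Z' where "Z' i = (case i of 0 \<Rightarrow> q | Suc i \<Rightarrow> (\<lambda>x. inverse (c i) * Z i x))" for i
    have kd: "k div 2 = Suc (e div 2)" using k by simp
    have "Z' i \<in> harmonics (k - 2 * i)" if "i \<le> k div 2" for i
    proof (cases i)
      case 0
      with q show ?thesis by (simp add: Z'_def)
    next
      case (Suc j)
      with that kd have "Z j \<in> harmonics (e - 2 * j)" by (intro Z) auto
      moreover have "k - 2 * i = e - 2 * j" using Suc k by simp
      ultimately show ?thesis
        using Suc by (auto simp: Z'_def harmonics_def laplacian_cmult homogeneous_polys_def fun_scale_in_span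
            intro!: laplacian_cmult[THEN trans])
    qed
    moreover have "p x = (\<Sum>i=0..k div 2. (norm x) ^ (2 * i) * Z' i x)" for x
      unfolding kd sum.atLeast0_atMost_Suc_shift
      by (simp add: Z'_def q_def T_def mult.left_commute del: power_Suc)
    ultimately show ?thesis by (intro exI[of _ Z'] conjI ballI allI) auto
  qed
qed

section \<open>Polar coordinates\<close>

lemma sets_surface_measure [measurable_cong, simp]: "sets surface_measure = sets borel"
  by (simp add: surface_measure_def)

lemma space_surface_measure [simp]: "space surface_measure = UNIV"
  by (simp add: surface_measure_def)

lemma borel_measurable_sgn_euclidean [measurable]: "(sgn :: 'a::euclidean_space \<Rightarrow> 'a) \<in> borel_measurable borel"
  unfolding sgn_div_norm[abs_def] by measurable

lemma emeasure_surface_measure: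
  fixes A :: "'a::euclidean_space set"
  assumes [measurable]: "A \<in> sets borel"
  shows "emeasure surface_measure A =
           ennreal (real DIM('a)) * emeasure lborel {x. norm x < 1 \<and> sgn x \<in> A}"
proof -
  have "emeasure surface_measure A =
      emeasure (density lborel (\<lambda>x. ennreal (real DIM('a)) * indicator (ball 0 1) x)) (sgn -` A \<inter> space borel)"
    unfolding surface_measure_def
    using measurable_sets[OF borel_measurable_sgn_euclidean assms] by (subst emeasure_distr) auto
  also have "\<dots> = (\<integral>\<^sup>+x. ennreal (real DIM('a)) * indicator {x. norm x < 1 \<and> sgn x \<in> A} x \<partial>lborel)"
    using measurable_sets[OF borel_measurable_sgn_euclidean assms]
    by (subst emeasure_density) (auto intro!: nn_integral_cong simp: indicator_def)
  also have "\<dots> = ennreal (real DIM('a)) * emeasure lborel {x. norm x < 1 \<and> sgn x \<in> A}"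
    by (subst nn_integral_cmult_indicator) auto
  finally show ?thesis .
qed

lemma finite_measure_surface_measure: "finite_measure (surface_measure :: 'a::euclidean_space measure)"
proof
  have "{x::'a. norm x < 1} = ball 0 1" by auto
  then show "emeasure (surface_measure :: 'a measure) (space surface_measure) \<noteq> \<infinity>"
    using emeasure_lborel_ball_finite[of "0::'a" 1]
    by (simp add: emeasure_surface_measure ennreal_mult_eq_top_iff less_top)
qed

lemma AE_surface_measure: "AE \<xi> in (surface_measure :: 'a::euclidean_space measure). norm \<xi> = 1"
proof -
  have "AE x in lborel. x \<in> ball 0 1 \<longrightarrow> norm (sgn x :: 'a) = 1"
    using AE_lborel_singleton[of "0::'a"] by eventually_elim (auto simp: norm_sgn)
  then have "AE x in density lborel (\<lambda>x. ennreal (real DIM('a)) * indicator (ball 0 1) x). norm (sgn x :: 'a) = 1"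
    by (subst AE_density) (auto simp: indicator_def)
  then show ?thesis
    unfolding surface_measure_def by (subst AE_distr_iff) auto
qed

text \<open>\<open>sgn\<close> is unchanged under scaling by \<open>r > 0\<close>, so the cone of
  radius \<open>r\<close> is a dilate of the unit cone.\<close>

lemma emeasure_cone:
  fixes A :: "'a::euclidean_space set"
  assumes [measurable]: "A \<in> sets borel" and r: "0 < r"
  shows "emeasure lborel {x. norm x < r \<and> sgn x \<in> A} =
           ennreal (r ^ DIM('a)) * emeasure lborel {x. norm x < 1 \<and> sgn x \<in> A}"
proof -
  have [measurable]: "(\<lambda>x. 0 + r *\<^sub>R x) \<in> borel_measurable (borel :: 'a measure)" by measurable
  have "emeasure lborel {x. norm x < r \<and> sgn x \<in> A} =
      emeasure (density (distr lborel borel (\<lambda>x. 0 + r *\<^sub>R x)) (\<lambda>_. ennreal (\<bar>r\<bar> ^ DIM('a)))) {x. norm x < r \<and> sgn x \<in> A}"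
    using r by (subst lborel_affine[of r 0]) auto
  also have "\<dots> = ennreal (r ^ DIM('a)) *
      emeasure (distr lborel borel (\<lambda>x. 0 + r *\<^sub>R x)) {x. norm x < r \<and> sgn x \<in> A}"
    using r by (subst emeasure_density) (auto simp: nn_integral_cmult_indicator)
  also have "emeasure (distr lborel borel (\<lambda>x. 0 + r *\<^sub>R x)) {x. norm x < r \<and> sgn x \<in> A} =
      emeasure lborel ((\<lambda>x. 0 + r *\<^sub>R x) -` {x. norm x < r \<and> sgn x \<in> A})"
    by (subst emeasure_distr) auto
  also have "(\<lambda>x. 0 + r *\<^sub>R x) -` {x. norm x < r \<and> sgn x \<in> A} = {x. norm x < 1 \<and> sgn x \<in> A}"
    using r by (auto simp: sgn_scaleR mult_less_cancel_left_pos[of r _ 1, simplified])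
  finally show ?thesis .
qed

text \<open>Extended by \<open>0\<close> to negative radii, so that radial integrals run over the
  whole line. For \<open>d = 1\<close> it is the indicator of \<open>{0..}\<close>, which later
  turns polar coordinates on the line into a statement on parity.\<close>

definition radial_density :: "nat \<Rightarrow> real \<Rightarrow> real" where
  "radial_density d r = (if 0 \<le> r then r ^ (d - 1) else 0)"

lemma radial_density_measurable [measurable]: "radial_density d \<in> borel_measurable borel"
  unfolding radial_density_def[abs_def] by measurable

lemma radial_density_fst_measurable [measurable]:
  "(\<lambda>u::real \<times> real. radial_density d (fst u)) \<in> borel_measurable borel"
  by (intro measurable_compose[OF borel_measurable_continuous_onI radial_density_measurable] continuous_intros)

lemma radial_density_nonneg [simp]: "0 \<le> radial_density d r"
  by (simp add: radial_density_def)

lemma nn_integral_radial_density: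
  assumes "0 < d" "0 < r"
  shows "(\<integral>\<^sup>+s. ennreal (radial_density d s) * indicator {..<r} s \<partial>lborel) = ennreal (r ^ d / d)"
proof -
  have "(\<integral>\<^sup>+s. ennreal (radial_density d s) * indicator {..<r} s \<partial>lborel)
      = (\<integral>\<^sup>+s. ennreal (s ^ (d - 1)) * indicator {0..r} s \<partial>lborel)"
    using AE_lborel_singleton[of r]
    by (intro nn_integral_cong_AE, eventually_elim) (auto simp: radial_density_def indicator_def)
  also have "\<dots> = ennreal (r ^ d / d - 0 ^ d / real d)"
    using assms
    by (intro nn_integral_FTC_Icc) (auto intro!: derivative_eq_intros)
  also have "0 ^ d / real d = 0" using assms by (simp add: power_0_left)
  finally show ?thesis by simp
qed

text \<open>For fixed \<open>B\<close> both sides are measures in \<open>A\<close>, so it suffices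
  to compare them on the intervals \<open>{..<r}\<close>. There the left side is a cone of volume
  \<open>r ^ DIM('a)\<close> times that of the unit cone, and on the right the radial factor
  \<open>r ^ DIM('a) / DIM('a)\<close> meets the factor \<open>DIM('a)\<close> built into
  \<open>surface_measure\<close>.\<close>

lemma polar_rectangle:
  fixes B :: "'a::euclidean_space set" and A :: "real set"
  assumes A [measurable]: "A \<in> sets borel" and B [measurable]: "B \<in> sets borel"
  shows "emeasure lborel {x. norm x \<in> A \<and> sgn x \<in> B} =
           emeasure (density lborel (\<lambda>r. ennreal (radial_density DIM('a) r))) A * emeasure surface_measure B"
proof -
  define M where "M = distr (density lborel (indicator {x::'a. sgn x \<in> B})) borel norm"
  define N where "N = scale_measure (emeasure surface_measure B)
    (density lborel (\<lambda>r. ennreal (radial_density DIM('a) r)))"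
  interpret finite_measure "surface_measure :: 'a measure" by (rule finite_measure_surface_measure)
  have M: "emeasure M C = emeasure lborel {x. norm x \<in> C \<and> sgn x \<in> B}" if [measurable]: "C \<in> sets borel" for C
  proof -
    have "emeasure M C = emeasure (density lborel (indicator {x::'a. sgn x \<in> B})) (norm -` C \<inter> space borel)"
      unfolding M_def by (subst emeasure_distr) auto
    also have "\<dots> = (\<integral>\<^sup>+x. indicator {x::'a. sgn x \<in> B} x * indicator (norm -` C \<inter> space borel) x \<partial>lborel)"
      using measurable_sets[OF borel_measurable_continuous_onI[OF continuous_on_norm_id] that]
      by (intro emeasure_density) auto
    also have "\<dots> = (\<integral>\<^sup>+x. indicator {x. norm x \<in> C \<and> sgn x \<in> B} x \<partial>lborel)"
      by (intro nn_integral_cong) (simp split: split_indicator)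
    finally show ?thesis by simp
  qed
  have eq: "emeasure M {..<r} = emeasure N {..<r}" for r
  proof (cases "0 < r")
    case True
    have "ennreal (r ^ DIM('a) / DIM('a)) * ennreal (real DIM('a)) = ennreal (r ^ DIM('a))"
      using True by (simp flip: ennreal_mult')
    moreover have "emeasure M {..<r} = ennreal (r ^ DIM('a)) * emeasure lborel {x. norm x < 1 \<and> sgn x \<in> B}"
      using emeasure_cone[OF B True] by (simp add: M)
    moreover have "emeasure N {..<r} = ennreal (r ^ DIM('a) / DIM('a)) *
        (ennreal (real DIM('a)) * emeasure lborel {x. norm x < 1 \<and> sgn x \<in> B})"
      using True by (simp add: N_def emeasure_density nn_integral_radial_density emeasure_surface_measure
          mult.commute[of _ "ennreal (r ^ DIM('a) / DIM('a))"])
    ultimately show ?thesis by (simp only: mult.assoc[symmetric])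
  next
    case False
    have e: "{x::'a. norm x < r \<and> sgn x \<in> B} = {}"
      using False by (auto dest: le_less_trans[OF norm_ge_zero])
    have "(\<integral>\<^sup>+s. ennreal (radial_density DIM('a) s) * indicator {..<r} s \<partial>lborel) = (\<integral>\<^sup>+s. 0 \<partial>(lborel :: real measure))"
      using False by (intro nn_integral_cong) (auto simp: radial_density_def indicator_def)
    then show ?thesis by (simp add: M N_def e emeasure_density)
  qed
  have "M = N"
  proof (rule measure_eqI_generator_eq[where E = "range lessThan" and \<Omega> = UNIV and A = "\<lambda>i. {..<real i}"])
    show "Int_stable (range (lessThan :: real \<Rightarrow> _))"
    proof -
      have "{..<a} \<inter> {..<b} = {..<min a b}" for a b :: real by auto
      then show ?thesis by (auto simp: Int_stable_def)
    qed
    have "sets borel = sigma_sets UNIV (range (lessThan :: real \<Rightarrow> _))"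
      using arg_cong[OF borel_eq_lessThan[where ?'a = real], of sets] by (simp add: eucl_lessThan sets_measure_of)
    then show "sets M = sigma_sets UNIV (range lessThan)" "sets N = sigma_sets UNIV (range lessThan)"
      by (simp_all add: M_def N_def)
    show "(\<Union>i. {..<real i}) = UNIV" using reals_Archimedean2 by auto
    fix i :: nat
    show "emeasure M {..<real i} \<noteq> \<infinity>"
    proof (cases "0 < real i")
      case True
      then show ?thesis
        unfolding eq N_def
        by (simp add: emeasure_density nn_integral_radial_density ennreal_mult_eq_top_iff)
    qed (use eq in \<open>auto simp: M not_less order.strict_trans1\<close>)
  qed (auto simp: eq)
  then have "emeasure M A = emeasure N A" by simp
  then show ?thesis by (simp add: M N_def mult.commute)
qed

section \<open>Image measures of polar and cylindrical coordinates\<close>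

lemma sigma_finite_density_real:
  fixes f :: "'a::euclidean_space \<Rightarrow> real"
  assumes "f \<in> borel_measurable borel"
  shows "sigma_finite_measure (density lborel (\<lambda>x. ennreal (f x)))"
  using assms by (subst sigma_finite_measure.sigma_finite_iff_density_finite[OF sigma_finite_lborel]) auto

lemma distr_polar:
  "distr lborel (borel \<Otimes>\<^sub>M borel) (\<lambda>x::'a::euclidean_space. (norm x, sgn x)) =
     density lborel (\<lambda>r. ennreal (radial_density DIM('a) r)) \<Otimes>\<^sub>M surface_measure"
proof (rule pair_measure_eqI[symmetric])
  show "sigma_finite_measure (density lborel (\<lambda>r. ennreal (radial_density DIM('a) r)))"
    by (rule sigma_finite_density_real) measurable
  show "sigma_finite_measure (surface_measure :: 'a measure)"
    using finite_measure_surface_measure by (rule finite_measure.axioms)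
  show "sets (density lborel (\<lambda>r. ennreal (radial_density DIM('a) r)) \<Otimes>\<^sub>M surface_measure) =
      sets (distr lborel (borel \<Otimes>\<^sub>M borel) (\<lambda>x::'a. (norm x, sgn x)))"
    by (simp cong: sets_pair_measure_cong)
next
  fix A and B :: "'a set"
  assume "A \<in> sets (density lborel (\<lambda>r. ennreal (radial_density DIM('a) r)))" "B \<in> sets surface_measure"
  then have [measurable]: "A \<in> sets borel" "B \<in> sets borel" by auto
  have "emeasure (distr lborel (borel \<Otimes>\<^sub>M borel) (\<lambda>x. (norm x, sgn x))) (A \<times> B)
      = emeasure lborel {x. norm x \<in> A \<and> sgn x \<in> B}"
    by (subst emeasure_distr) (auto intro!: arg_cong[where f = "emeasure lborel"])
  then show "emeasure (density lborel (\<lambda>r. ennreal (radial_density DIM('a) r))) A * emeasure surface_measure B =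
      emeasure (distr lborel (borel \<Otimes>\<^sub>M borel) (\<lambda>x. (norm x, sgn x))) (A \<times> B)"
    by (simp add: polar_rectangle)
qed

lemma cylindrical_measurable:
  "(\<lambda>z::'a::euclidean_space \<times> real. ((norm (fst z), snd z), sgn (fst z))) \<in> lborel \<rightarrow>\<^sub>M (borel \<Otimes>\<^sub>M borel)"
proof -
  have "(\<lambda>z::'a \<times> real. (norm (fst z), snd z)) \<in> borel_measurable borel"
    by (intro borel_measurable_continuous_onI continuous_intros)
  moreover have "(\<lambda>z::'a \<times> real. sgn (fst z)) \<in> borel_measurable borel"
    by (intro measurable_compose[OF borel_measurable_continuous_onI borel_measurable_sgn_euclidean]
        continuous_intros)
  ultimately show ?thesis by (intro measurable_Pair) auto
qed

text \<open>The coordinates are grouped as \<open>((norm x, t), sgn x)\<close> because the plane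
  weight depends on the first pair and the spherical factor on the last entry. With \<open>t\<close>
  integrated outermost, each slice in \<open>x\<close> is a case of \<open>polar_rectangle\<close>
  with the section of \<open>A\<close> at height \<open>t\<close>.\<close>

lemma distr_cylindrical:
  "distr lborel (borel \<Otimes>\<^sub>M borel) (\<lambda>z::'a::euclidean_space \<times> real. ((norm (fst z), snd z), sgn (fst z))) =
     density lborel (\<lambda>u::real \<times> real. ennreal (radial_density DIM('a) (fst u))) \<Otimes>\<^sub>M surface_measure"
    (is "?L = ?R")
proof (rule pair_measure_eqI[symmetric])
  show "sigma_finite_measure (density lborel (\<lambda>u::real \<times> real. ennreal (radial_density DIM('a) (fst u))))"
    by (rule sigma_finite_density_real) measurable
  show sf: "sigma_finite_measure (surface_measure :: 'a measure)"
    using finite_measure_surface_measure by (rule finite_measure.axioms)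
  show "sets ?R = sets ?L"
    by (simp cong: sets_pair_measure_cong)
  fix A :: "(real \<times> real) set" and B :: "'a set"
  assume "A \<in> sets (density lborel (\<lambda>u. ennreal (radial_density DIM('a) (fst u))))" "B \<in> sets surface_measure"
  then have [measurable]: "A \<in> sets borel" "B \<in> sets borel" by auto
  have [measurable]: "A \<in> sets (borel \<Otimes>\<^sub>M borel)"
    using \<open>A \<in> sets borel\<close> unfolding borel_prod .
  note m [measurable] = cylindrical_measurable[where ?'a = 'a]
  have "(\<lambda>z::'a \<times> real. ((norm (fst z), snd z), sgn (fst z))) -` (A \<times> B) \<inter> space lborel \<in> sets (borel \<Otimes>\<^sub>M borel)"
    using measurable_sets[OF m pair_measureI[of A borel B borel]] unfolding borel_prod by simp
  then have [measurable]: "{z. (norm (fst z), snd z) \<in> A \<and> sgn (fst z) \<in> B} \<in> sets (borel \<Otimes>\<^sub>M borel)"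
    by (simp add: vimage_def)
  have "emeasure ?L (A \<times> B) = emeasure lborel {z. (norm (fst z), snd z) \<in> A \<and> sgn (fst z) \<in> B}"
    by (subst emeasure_distr[OF m]) (auto intro!: arg_cong[where f = "emeasure lborel"])
  also have "\<dots> = (\<integral>\<^sup>+z. indicator {z. (norm (fst z), snd z) \<in> A \<and> sgn (fst z) \<in> B} z \<partial>(lborel \<Otimes>\<^sub>M lborel))"
    by (subst nn_integral_indicator) (auto simp: lborel_prod simp del: space_pair_measure)
  also have "\<dots> = (\<integral>\<^sup>+t. \<integral>\<^sup>+x. indicator {z. (norm (fst z), snd z) \<in> A \<and> sgn (fst z) \<in> B} (x, t) \<partial>lborel \<partial>lborel)"
    by (rule lborel_pair.nn_integral_snd[symmetric]) measurable
  also have "\<dots> = (\<integral>\<^sup>+t. (\<integral>\<^sup>+r. ennreal (radial_density DIM('a) r) * indicator A (r, t) \<partial>lborel) * emeasure surface_measure B \<partial>lborel)"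
  proof (rule nn_integral_cong)
    fix t :: real
    have [measurable]: "{r. (r, t) \<in> A} \<in> sets borel"
    proof -
      have "(\<lambda>r. (r, t)) -` A \<inter> space borel \<in> sets (borel :: real measure)"
        by (rule measurable_sets[of _ _ "borel \<Otimes>\<^sub>M borel"]) measurable
      then show ?thesis by (simp add: vimage_def)
    qed
    have "(\<integral>\<^sup>+x. indicator {z. (norm (fst z), snd z) \<in> A \<and> sgn (fst z) \<in> B} (x, t) \<partial>lborel)
      = (\<integral>\<^sup>+x. indicator {x. norm x \<in> {r. (r, t) \<in> A} \<and> sgn x \<in> B} x \<partial>lborel)"
      by (intro nn_integral_cong) (auto simp: indicator_def)
    also have "\<dots> = emeasure lborel {x. norm x \<in> {r. (r, t) \<in> A} \<and> sgn x \<in> B}"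
      by (rule nn_integral_indicator) measurable
    also have "\<dots> = emeasure (density lborel (\<lambda>r. ennreal (radial_density DIM('a) r))) {r. (r, t) \<in> A} * emeasure surface_measure B"
      by (rule polar_rectangle) measurable
    also have "emeasure (density lborel (\<lambda>r. ennreal (radial_density DIM('a) r))) {r. (r, t) \<in> A} =
        (\<integral>\<^sup>+r. ennreal (radial_density DIM('a) r) * indicator A (r, t) \<partial>lborel)"
      by (subst emeasure_density) (auto intro!: nn_integral_cong simp: indicator_def)
    finally show "(\<integral>\<^sup>+x. indicator {z. (norm (fst z), snd z) \<in> A \<and> sgn (fst z) \<in> B} (x, t) \<partial>lborel) =
      (\<integral>\<^sup>+r. ennreal (radial_density DIM('a) r) * indicator A (r, t) \<partial>lborel) * emeasure surface_measure B" .
  qed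
  also have "\<dots> = (\<integral>\<^sup>+t. (\<integral>\<^sup>+r. ennreal (radial_density DIM('a) r) * indicator A (r, t) \<partial>lborel) \<partial>lborel) * emeasure surface_measure B"
    by (rule nn_integral_multc) measurable
  also have "(\<integral>\<^sup>+t. (\<integral>\<^sup>+r. ennreal (radial_density DIM('a) r) * indicator A (r, t) \<partial>lborel) \<partial>lborel) =
      (\<integral>\<^sup>+u. ennreal (radial_density DIM('a) (fst u)) * indicator A u \<partial>(lborel \<Otimes>\<^sub>M lborel))"
    by (subst lborel_pair.nn_integral_snd[symmetric]) simp_all
  also have "\<dots> = emeasure (density lborel (\<lambda>u. ennreal (radial_density DIM('a) (fst u)))) A"
    by (simp add: emeasure_density lborel_prod)
  finally show "emeasure (density lborel (\<lambda>u. ennreal (radial_density DIM('a) (fst u)))) A * emeasure surface_measure B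
      = emeasure ?L (A \<times> B)" by simp
qed

section \<open>Integrals in polar and cylindrical coordinates\<close>

lemma (in pair_sigma_finite) has_bochner_integral_product:
  fixes f :: "'a \<Rightarrow> real" and g :: "'b \<Rightarrow> real"
  assumes f: "integrable M1 f" and g: "integrable M2 g"
  shows "has_bochner_integral (M1 \<Otimes>\<^sub>M M2) (\<lambda>z. f (fst z) * g (snd z))
           (integral\<^sup>L M1 f * integral\<^sup>L M2 g)"
proof -
  note [measurable] = borel_measurable_integrable[OF f] borel_measurable_integrable[OF g]
  have "integrable (M1 \<Otimes>\<^sub>M M2) (\<lambda>z. f (fst z) * g (snd z))"
  proof (rule Fubini_integrable)
    show "(\<lambda>z. f (fst z) * g (snd z)) \<in> borel_measurable (M1 \<Otimes>\<^sub>M M2)" by measurable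
    show "integrable M1 (\<lambda>x. \<integral>y. norm (f (fst (x, y)) * g (snd (x, y))) \<partial>M2)"
      using f g by (simp add: abs_mult)
    show "AE x in M1. integrable M2 (\<lambda>y. f (fst (x, y)) * g (snd (x, y)))"
      using g by simp
  qed
  moreover from integral_fst'[OF this]
  have "integral\<^sup>L (M1 \<Otimes>\<^sub>M M2) (\<lambda>z. f (fst z) * g (snd z)) = integral\<^sup>L M1 f * integral\<^sup>L M2 g"
    by simp
  ultimately show ?thesis by (simp add: has_bochner_integral_iff)
qed

lemma has_bochner_integral_distrD:
  fixes f :: "'a \<Rightarrow> 'b::{banach, second_countable_topology}"
  assumes "has_bochner_integral (distr M N g) f x" "f \<in> borel_measurable N" "g \<in> measurable M N"
  shows "has_bochner_integral M (\<lambda>x. f (g x)) x"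
  using assms by (simp add: has_bochner_integral_iff integrable_distr_eq integral_distr)

lemma polar_integral:
  fixes f :: "real \<Rightarrow> real" and g :: "'a::euclidean_space \<Rightarrow> real"
  assumes [measurable]: "f \<in> borel_measurable borel"
    and f: "integrable lborel (\<lambda>r. radial_density DIM('a) r * f r)"
    and g: "integrable surface_measure g"
  shows "has_bochner_integral lborel (\<lambda>x. f (norm x) * g (sgn x))
           ((\<integral>r. radial_density DIM('a) r * f r \<partial>lborel) * integral\<^sup>L surface_measure g)"
proof -
  let ?M = "density lborel (\<lambda>r. ennreal (radial_density DIM('a) r))"
  have [measurable]: "g \<in> borel_measurable borel"
    using borel_measurable_integrable[OF g] by simp
  interpret finite_measure "surface_measure :: 'a measure" by (rule finite_measure_surface_measure)
  interpret M: sigma_finite_measure ?M by (rule sigma_finite_density_real) measurable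
  interpret P: pair_sigma_finite ?M "surface_measure :: 'a measure" ..
  have "integrable ?M f" using f by (subst integrable_density) auto
  from P.has_bochner_integral_product[OF this g]
  have "has_bochner_integral (distr lborel (borel \<Otimes>\<^sub>M borel) (\<lambda>x::'a. (norm x, sgn x))) (\<lambda>z. f (fst z) * g (snd z))
     (integral\<^sup>L ?M f * integral\<^sup>L surface_measure g)"
    unfolding distr_polar .
  from has_bochner_integral_distrD[OF this]
  have "has_bochner_integral lborel (\<lambda>x. f (norm x) * g (sgn x))
      (integral\<^sup>L ?M f * integral\<^sup>L surface_measure g)"
    by simp
  moreover have "integral\<^sup>L ?M f = (\<integral>r. radial_density DIM('a) r * f r \<partial>lborel)"
    by (subst integral_density) auto
  ultimately show ?thesis by simp
qed

lemma AE_lborel_fst_nonzero: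
  "AE z in (lborel :: ('a::euclidean_space \<times> 'b::euclidean_space) measure). fst z \<noteq> 0"
proof -
  have "open {z :: 'a \<times> 'b. fst z \<noteq> 0}"
    by (intro open_Collect_neq continuous_intros)
  then have "{z :: 'a \<times> 'b. fst z \<noteq> 0} \<in> sets (borel \<Otimes>\<^sub>M borel)"
    unfolding borel_prod by (rule borel_open)
  then have "AE z::'a \<times> 'b in lborel \<Otimes>\<^sub>M lborel. fst z \<noteq> 0"
    using AE_lborel_singleton[of "0::'a"]
    by (intro lborel_pair.AE_pair_measure) (auto simp: space_pair_measure)
  then show ?thesis unfolding lborel_prod .
qed

text \<open>The measure with the radial density is absolutely continuous, so a null set of the plane
  has a null preimage. Radius zero is exempt because the points with \<open>fst z = 0\<close> form a
  null set.\<close>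

lemma AE_cylindrical:
  assumes "AE u in (lborel :: (real \<times> real) measure). 0 < fst u \<longrightarrow> Q u"
  shows "AE z in (lborel :: ('a::euclidean_space \<times> real) measure). Q (norm (fst z), snd z)"
proof -
  note m [measurable] = cylindrical_measurable[where ?'a = 'a]
  obtain N where N: "{u. \<not> (0 < fst u \<longrightarrow> Q u)} \<subseteq> N" "N \<in> null_sets (lborel :: (real \<times> real) measure)"
    using assms by (auto elim!: AE_E simp: null_sets_def)
  let ?D = "density lborel (\<lambda>u::real \<times> real. ennreal (radial_density DIM('a) (fst u)))"
  have "N \<in> null_sets ?D"
    using N(2) absolutely_continuousI_density[of "\<lambda>u::real \<times> real. ennreal (radial_density DIM('a) (fst u))" lborel]
    by (auto simp: absolutely_continuous_def)
  have [measurable]: "N \<in> sets borel" using N(2) by auto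
  have "sigma_finite_measure (surface_measure :: 'a measure)"
    using finite_measure_surface_measure by (rule finite_measure.axioms)
  then have "emeasure (?D \<Otimes>\<^sub>M (surface_measure :: 'a measure)) (N \<times> UNIV) = 0"
    using \<open>N \<in> null_sets ?D\<close>
    by (subst sigma_finite_measure.emeasure_pair_measure_Times) auto
  then have "emeasure lborel {z::'a \<times> real. (norm (fst z), snd z) \<in> N} = 0"
    unfolding distr_cylindrical[symmetric] by (subst (asm) emeasure_distr[OF m]) (auto simp: vimage_def)
  moreover have "{z::'a \<times> real. (norm (fst z), snd z) \<in> N} \<in> sets lborel"
  proof -
    have "(\<lambda>z::'a \<times> real. ((norm (fst z), snd z), sgn (fst z))) -` (N \<times> UNIV) \<inter> space lborel \<in> sets lborel"
      by (rule measurable_sets[OF m]) auto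
    then show ?thesis by (simp add: vimage_def)
  qed
  ultimately have 1: "AE z::'a \<times> real in lborel. (norm (fst z), snd z) \<notin> N"
    by (intro AE_I[of _ _ "{z. (norm (fst z), snd z) \<in> N}"]) auto
  have "Q u" if "0 < fst u" "u \<notin> N" for u using N(1) that by auto
  note Q = this
  from 1 AE_lborel_fst_nonzero[where ?'a = 'a and ?'b = real] show ?thesis
    by eventually_elim (rule Q, auto)
qed

text \<open>\<open>F\<close> is measurable only for the completion, where composition with
  \<open>(norm (fst z), snd z)\<close> need not be measurable. A Borel function \<open>G\<close>,
  equal to \<open>F\<close> almost everywhere at positive radii, is integrated instead;
  \<open>AE_cylindrical\<close> carries the equality, and with it measurability, back to
  \<open>F\<close>.\<close>

lemma cylindrical_integral:
  fixes F :: "real \<times> real \<Rightarrow> real" and g :: "'a::euclidean_space \<Rightarrow> real"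
  assumes F: "integrable lebesgue (\<lambda>u. radial_density DIM('a) (fst u) * F u)"
    and g: "integrable surface_measure g"
  shows "has_bochner_integral lebesgue (\<lambda>z. F (norm (fst z), snd z) * g (sgn (fst z)))
           ((\<integral>u. radial_density DIM('a) (fst u) * F u \<partial>lebesgue) * integral\<^sup>L surface_measure g)"
proof -
  let ?w = "\<lambda>u::real \<times> real. radial_density DIM('a) (fst u)"
  let ?M = "density lborel (\<lambda>u. ennreal (?w u))"
  have [measurable]: "g \<in> borel_measurable borel"
    using borel_measurable_integrable[OF g] by simp
  note [measurable] = cylindrical_measurable[where ?'a = 'a]
  obtain F' where [measurable]: "F' \<in> borel_measurable borel"
    and F': "AE u in lborel. ?w u * F u = F' u"
    using completion_ex_borel_measurable_real[OF borel_measurable_integrable[OF F]] by auto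
  \<comment> \<open>Division undoes the density; where the density is \<open>0\<close> the quotient
    is \<open>0\<close>, and those points carry no mass.\<close>
  define G where "G u = F' u / ?w u" for u
  have G [measurable]: "G \<in> borel_measurable borel" unfolding G_def by measurable
  have FG: "AE u in lborel. 0 < fst u \<longrightarrow> F u = G u"
    using F' by eventually_elim (auto simp: G_def radial_density_def field_simps)
  have 0: "AE u in lborel. fst u \<noteq> (0::real) \<and> ?w u * F u = F' u"
    using F' AE_lborel_fst_nonzero by eventually_elim auto
  have wG: "AE u in lborel. ?w u * F u = ?w u * G u"
    using 0 by eventually_elim (auto simp: G_def radial_density_def field_simps)
  have "integrable lebesgue (\<lambda>u. ?w u * G u)"
  proof (rule integrable_cong_AE_imp[OF F])
    show "(\<lambda>u. ?w u * G u) \<in> borel_measurable lebesgue"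
      by (rule measurable_completion) measurable
    show "AE u in lebesgue. ?w u * F u = ?w u * G u"
      by (rule AE_completion[OF wG])
  qed
  then have "integrable lborel (\<lambda>u. ?w u * G u)"
    by (rule integrable_completion[THEN iffD1, rotated]) measurable
  then have MG: "integrable ?M G"
    by (subst integrable_density) simp_all
  interpret finite_measure "surface_measure :: 'a measure" by (rule finite_measure_surface_measure)
  interpret M: sigma_finite_measure ?M by (rule sigma_finite_density_real) measurable
  interpret P: pair_sigma_finite ?M "surface_measure :: 'a measure" ..
  from P.has_bochner_integral_product[OF MG g]
  have "has_bochner_integral (distr lborel (borel \<Otimes>\<^sub>M borel)
       (\<lambda>z::'a \<times> real. ((norm (fst z), snd z), sgn (fst z)))) (\<lambda>z. G (fst z) * g (snd z))
     (integral\<^sup>L ?M G * integral\<^sup>L surface_measure g)"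
    unfolding distr_cylindrical .
  from has_bochner_integral_distrD[OF this]
  have H: "has_bochner_integral lborel (\<lambda>z::'a \<times> real. G (norm (fst z), snd z) * g (sgn (fst z)))
      (integral\<^sup>L ?M G * integral\<^sup>L surface_measure g)"
    by simp
  have I: "integral\<^sup>L ?M G = (\<integral>u. ?w u * F u \<partial>lebesgue)"
  proof -
    have "integral\<^sup>L ?M G = (\<integral>u. ?w u * G u \<partial>lborel)"
      by (subst integral_density) auto
    also have "\<dots> = (\<integral>u. ?w u * G u \<partial>lebesgue)" by (rule integral_completion[symmetric]) auto
    also have "\<dots> = (\<integral>u. ?w u * F u \<partial>lebesgue)"
    proof (rule integral_cong_AE)
      show "(\<lambda>u. ?w u * G u) \<in> borel_measurable lebesgue"
        by (rule measurable_completion) measurable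
      show "AE u in lebesgue. ?w u * G u = ?w u * F u"
        using AE_completion[OF wG] by eventually_elim (rule sym)
    qed (rule borel_measurable_integrable[OF F])
    finally show ?thesis .
  qed
  have H': "has_bochner_integral lebesgue (\<lambda>z::'a \<times> real. G (norm (fst z), snd z) * g (sgn (fst z)))
      ((\<integral>u. ?w u * F u \<partial>lebesgue) * integral\<^sup>L surface_measure g)"
    using H unfolding I has_bochner_integral_iff
    by (auto simp: integrable_completion integral_completion dest: borel_measurable_integrable)
  have ae: "AE z::'a \<times> real in lebesgue. G (norm (fst z), snd z) * g (sgn (fst z)) = F (norm (fst z), snd z) * g (sgn (fst z))"
    using AE_completion[OF AE_cylindrical[OF FG]] by eventually_elim auto
  have G': "(\<lambda>z::'a \<times> real. G (norm (fst z), snd z) * g (sgn (fst z))) \<in> borel_measurable lebesgue"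
    using H' by (auto simp: has_bochner_integral_iff)
  have F'': "(\<lambda>z::'a \<times> real. F (norm (fst z), snd z) * g (sgn (fst z))) \<in> borel_measurable lebesgue"
    by (rule borel_measurable_AE[OF G' ae])
  from has_bochner_integral_cong_AE[OF G' F'' ae] H' show ?thesis by simp
qed

section \<open>Orthogonality on the sphere\<close>

definition gaussian_moment :: "nat \<Rightarrow> real" where
  "gaussian_moment n = (\<integral>x. std_normal_density x * x ^ n \<partial>lborel)"

lemma gaussian_moment_even: "gaussian_moment (2 * k) = fact (2 * k) / (2 ^ k * fact k)"
  unfolding gaussian_moment_def by (rule integral_std_normal_moment_even)

lemma gaussian_moment_odd: "gaussian_moment (2 * k + 1) = 0"
  unfolding gaussian_moment_def by (rule integral_std_normal_moment_odd)

text \<open>This is integration by parts against the standard normal density in one variable,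
  obtained from the closed formulas for the moments. For \<open>n = 0\<close> the factor
  \<open>n\<close> hides the truncated \<open>n - 1\<close>.\<close>

lemma gaussian_moment_rec: "gaussian_moment (Suc n) = real n * gaussian_moment (n - 1)"
proof (cases "even n")
  case True
  then obtain k where n: "n = 2 * k" by (elim evenE)
  show ?thesis
  proof (cases k)
    case (Suc i)
    then have "n - 1 = 2 * i + 1" using n by simp
    then show ?thesis using gaussian_moment_odd[of k] gaussian_moment_odd[of i] n by simp
  qed (use gaussian_moment_odd[of 0] n in simp)
next
  case False
  then obtain k where n: "n = 2 * k + 1" by (elim oddE)
  then have "Suc n = 2 * Suc k" "n - 1 = 2 * k" by auto
  moreover have "fact (2 * Suc k) / (2 ^ Suc k * fact (Suc k)) = real n * (fact (2 * k) / (2 ^ k * fact k))"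
  proof -
    have "(a * b * f) / (b * g) = a * (f / g)" if "b \<noteq> 0" for a b f g :: real
      using that by simp
    from this[of "2 * real (Suc k)" "real n" "fact (2 * k)" "2 ^ k * fact k"] n
    show ?thesis by (simp add: algebra_simps)
  qed
  ultimately show ?thesis by (simp only: gaussian_moment_even)
qed

definition gaussian :: "'a::euclidean_space \<Rightarrow> real" where
  "gaussian x = (\<Prod>b\<in>Basis. std_normal_density (x \<bullet> b))"

text \<open>The product form makes moments factor over the coordinates, the radial form separates in
  polar coordinates; the Gaussian is chosen because it has both. The constant corrects the
  normalisation of the one-dimensional density.\<close>

lemma gaussian_radial:
  "\<exists>c>0. \<forall>x::'a::euclidean_space. gaussian x = c * std_normal_density (norm x)"
proof (intro exI[of _ "(1 / sqrt (2 * pi)) ^ DIM('a) * sqrt (2 * pi)"] conjI allI)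
  fix x :: 'a
  have "gaussian x = (1 / sqrt (2 * pi)) ^ DIM('a) * (\<Prod>b\<in>Basis. exp (- (x \<bullet> b)\<^sup>2 / 2))"
    unfolding gaussian_def std_normal_density_def by (subst prod.distrib) simp
  also have "(\<Prod>b\<in>Basis. exp (- (x \<bullet> b)\<^sup>2 / 2)) = exp (- (norm x)\<^sup>2 / 2)"
    unfolding norm_square_sum sum_negf[symmetric] sum_divide_distrib
    by (subst exp_sum) (auto simp: power2_eq_square)
  finally show "gaussian x = (1 / sqrt (2 * pi)) ^ DIM('a) * sqrt (2 * pi) * std_normal_density (norm x)"
    by (simp add: std_normal_density_def)
qed simp

lemma gaussian_monomial:
  fixes \<alpha> :: "'a::euclidean_space \<Rightarrow> nat"
  shows "has_bochner_integral lborel (\<lambda>x. gaussian x * monomial \<alpha> x) (\<Prod>b\<in>Basis. gaussian_moment (\<alpha> b))"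
proof -
  interpret product_sigma_finite "\<lambda>_::'a. lborel :: real measure" by standard
  let ?f = "\<lambda>b x. std_normal_density x * x ^ \<alpha> b"
  have "has_bochner_integral (\<Pi>\<^sub>M b\<in>(Basis::'a set). lborel) (\<lambda>f. \<Prod>b\<in>Basis. ?f b (f b)) (\<Prod>b\<in>Basis. gaussian_moment (\<alpha> b))"
    unfolding has_bochner_integral_iff gaussian_moment_def
    by (intro conjI product_integrable_prod product_integral_prod integrable_std_normal_moment) auto
  also have "(\<lambda>f. \<Prod>b\<in>(Basis::'a set). ?f b (f b)) =
      (\<lambda>f. (\<lambda>x. gaussian x * monomial \<alpha> x) (\<Sum>b\<in>Basis. f b *\<^sub>R b))"
    by (auto simp: gaussian_def monomial_def prod.distrib fun_eq_iff inner_sum_left_Basis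
        simp del: normal_density_def intro!: arg_cong2[where f = "(*)"] prod.cong)
  finally have "has_bochner_integral (distr (\<Pi>\<^sub>M b\<in>(Basis::'a set). lborel) borel (\<lambda>f. \<Sum>b\<in>Basis. f b *\<^sub>R b))
      (\<lambda>x. gaussian x * monomial \<alpha> x) (\<Prod>b\<in>Basis. gaussian_moment (\<alpha> b))"
    by (intro has_bochner_integral_distr) (auto simp: gaussian_def[abs_def] monomial_def[abs_def])
  then show ?thesis by (simp add: lborel_eq[symmetric])
qed

lemma gaussian_homogeneous_integrable:
  assumes "p \<in> homogeneous_polys k"
  shows "integrable lborel (\<lambda>x. gaussian x * p x)"
  using assms unfolding homogeneous_polys_def
proof (induction rule: fun_span_induct)
  case (base f)
  then show ?case using gaussian_monomial by (auto simp: has_bochner_integral_iff)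
next
  case (add f g)
  from Bochner_Integration.integrable_add[OF add(3,4)] show ?case by (simp add: algebra_simps)
next
  case (scale c f)
  from integrable_mult_right[OF scale(2), of c] show ?case by (simp add: algebra_simps)
qed simp

lemma gaussian_coord_monomial:
  fixes b :: "'a::euclidean_space"
  assumes b: "b \<in> Basis"
  shows "(\<integral>x. gaussian x * ((x \<bullet> b) * monomial \<alpha> x) \<partial>lborel) = \<alpha> b * (\<integral>x. gaussian x * monomial (\<alpha>(b := \<alpha> b - 1)) x \<partial>lborel)"
proof -
  have 1: "(x \<bullet> b) * monomial \<alpha> x = monomial (\<alpha>(b := Suc (\<alpha> b))) x" for x
  proof -
    have "(\<Prod>c\<in>Basis - {b}. (x \<bullet> c) ^ (\<alpha>(b := Suc (\<alpha> b))) c) = (\<Prod>c\<in>Basis - {b}. (x \<bullet> c) ^ \<alpha> c)"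
      by (intro prod.cong) auto
    then show ?thesis by (simp add: monomial_split[OF b])
  qed
  have I: "(\<integral>x. gaussian x * monomial (\<alpha>(b := n)) x \<partial>lborel)
      = gaussian_moment n * (\<Prod>c\<in>Basis - {b}. gaussian_moment (\<alpha> c))" for n
  proof -
    have "(\<Prod>c\<in>Basis - {b}. gaussian_moment ((\<alpha>(b := n)) c)) = (\<Prod>c\<in>Basis - {b}. gaussian_moment (\<alpha> c))"
      by (intro prod.cong) auto
    then show ?thesis
      using gaussian_monomial[of "\<alpha>(b := n)"] b
      by (simp add: has_bochner_integral_iff prod.remove[of Basis b])
  qed
  show ?thesis unfolding 1 I gaussian_moment_rec by simp
qed

text \<open>On monomials this is \<open>gaussian_moment_rec\<close> in the coordinate
  \<open>b\<close>, with the other coordinates factored out; both sides are linear in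
  \<open>p\<close>.\<close>

lemma gaussian_integration_by_parts:
  assumes p: "p \<in> homogeneous_polys k" and b: "b \<in> Basis"
  shows "(\<integral>x. gaussian x * ((x \<bullet> b) * p x) \<partial>lborel) = (\<integral>x. gaussian x * partial_deriv b p x \<partial>lborel)"
  using p unfolding homogeneous_polys_def
proof (induction rule: fun_span_induct)
  case (base f)
  then obtain \<alpha> where "f = monomial \<alpha>" by auto
  then show ?case
    using gaussian_coord_monomial[OF b, of \<alpha>]
    by (simp add: partial_deriv_monomial[OF b] mult.left_commute[of _ "real _"])
next
  case zero
  then show ?case by (simp add: partial_deriv_const)
next
  case (add f g)
  have f: "f \<in> homogeneous_polys k" and g: "g \<in> homogeneous_polys k"
    using add by (auto simp: homogeneous_polys_def)
  note i = gaussian_homogeneous_integrable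
  have "(\<integral>x. gaussian x * ((x \<bullet> b) * (f x + g x)) \<partial>lborel)
      = (\<integral>x. gaussian x * ((x \<bullet> b) * f x) + gaussian x * ((x \<bullet> b) * g x) \<partial>lborel)"
    by (simp add: algebra_simps)
  also have "\<dots> = (\<integral>x. gaussian x * ((x \<bullet> b) * f x) \<partial>lborel) + (\<integral>x. gaussian x * ((x \<bullet> b) * g x) \<partial>lborel)"
    by (intro Bochner_Integration.integral_add i[OF homogeneous_mult[OF coord_homogeneous[OF b] f]]
        i[OF homogeneous_mult[OF coord_homogeneous[OF b] g]])
  also have "\<dots> = (\<integral>x. gaussian x * partial_deriv b f x + gaussian x * partial_deriv b g x \<partial>lborel)"
    unfolding add
    by (intro Bochner_Integration.integral_add[symmetric] i[OF partial_deriv_homogeneous[OF f b]]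
        i[OF partial_deriv_homogeneous[OF g b]])
  finally show ?case by (simp add: partial_deriv_add[OF f g b] algebra_simps)
next
  case (scale c f)
  have f: "f \<in> homogeneous_polys k" using scale by (auto simp: homogeneous_polys_def)
  from scale(2) show ?case by (simp add: partial_deriv_cmult[OF f b] mult.left_commute[of _ c])
qed

text \<open>By Euler's identity and Gaussian integration by parts, \<open>k\<close> times the Gaussian integral of \<open>Y * Z\<close>
  is the Gaussian integral of the product of the gradients, which is symmetric in \<open>Y\<close> and \<open>Z\<close>.\<close>

lemma gaussian_dirichlet:
  fixes Y Z :: "'a::euclidean_space \<Rightarrow> real"
  assumes Y: "Y \<in> harmonics k" and Z: "Z \<in> harmonics m"
  shows "real k * (\<integral>x. gaussian x * (Y x * Z x) \<partial>lborel) =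
    (\<Sum>b\<in>Basis. \<integral>x. gaussian x * (partial_deriv b Y x * partial_deriv b Z x) \<partial>lborel)"
proof -
  have hY: "Y \<in> homogeneous_polys k" and hZ: "Z \<in> homogeneous_polys m" and LY: "\<And>x. laplacian Y x = 0"
    using Y Z by (auto simp: harmonics_def)
  note i = gaussian_homogeneous_integrable
  have dY: "partial_deriv b Y \<in> homogeneous_polys (k - 1)" if "b \<in> Basis" for b
    using partial_deriv_homogeneous[OF hY that] .
  have "real k * (\<integral>x. gaussian x * (Y x * Z x) \<partial>lborel) = (\<integral>x. gaussian x * ((real k * Y x) * Z x) \<partial>lborel)"
    by (simp add: mult_ac flip: integral_mult_right_zero)
  also have "\<dots> = (\<integral>x. (\<Sum>b\<in>Basis. gaussian x * ((x \<bullet> b) * (partial_deriv b Y x * Z x))) \<partial>lborel)"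
    unfolding euler_identity[OF hY, symmetric]
    by (simp add: sum_distrib_left sum_distrib_right mult_ac)
  also have "\<dots> = (\<Sum>b\<in>Basis. \<integral>x. gaussian x * ((x \<bullet> b) * (partial_deriv b Y x * Z x)) \<partial>lborel)"
    by (intro Bochner_Integration.integral_sum
        i[OF homogeneous_mult[OF coord_homogeneous homogeneous_mult[OF dY hZ]]])
  \<comment> \<open>Integration by parts is applied to the product of
    \<open>partial_deriv b Y\<close> and \<open>Z\<close>; the product rule splits off the second
    derivatives of \<open>Y\<close>, which add up to its Laplacian.\<close>
  also have "\<dots> = (\<Sum>b\<in>Basis. \<integral>x. gaussian x * (partial_deriv b (partial_deriv b Y) x * Z x)
      + gaussian x * (partial_deriv b Y x * partial_deriv b Z x) \<partial>lborel)"
    by (intro sum.cong refl)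
       (simp add: gaussian_integration_by_parts[OF homogeneous_mult[OF dY hZ]] partial_deriv_mult[OF dY hZ]
          distrib_left)
  also have "\<dots> = (\<Sum>b\<in>Basis. (\<integral>x. gaussian x * (partial_deriv b (partial_deriv b Y) x * Z x) \<partial>lborel)
      + (\<integral>x. gaussian x * (partial_deriv b Y x * partial_deriv b Z x) \<partial>lborel))"
    by (intro sum.cong refl Bochner_Integration.integral_add
        i[OF homogeneous_mult[OF partial_deriv_homogeneous[OF dY] hZ]]
        i[OF homogeneous_mult[OF dY partial_deriv_homogeneous[OF hZ]]])
  also have "\<dots> = (\<integral>x. (\<Sum>b\<in>Basis. gaussian x * (partial_deriv b (partial_deriv b Y) x * Z x)) \<partial>lborel)
      + (\<Sum>b\<in>Basis. \<integral>x. gaussian x * (partial_deriv b Y x * partial_deriv b Z x) \<partial>lborel)"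
    unfolding sum.distrib
    by (intro arg_cong2[where f = "(+)"] refl Bochner_Integration.integral_sum[symmetric]
        i[OF homogeneous_mult[OF partial_deriv_homogeneous[OF dY] hZ]])
  also have "(\<lambda>x. \<Sum>b\<in>Basis. gaussian x * (partial_deriv b (partial_deriv b Y) x * Z x)) = (\<lambda>x. gaussian x * (laplacian Y x * Z x))"
    unfolding laplacian_partial_deriv[OF hY] by (simp add: sum_distrib_left sum_distrib_right)
  finally show ?thesis by (simp add: LY)
qed

text \<open>Exchanging \<open>Y\<close> and \<open>Z\<close> leaves the right side of
  \<open>gaussian_dirichlet\<close> unchanged, so \<open>k\<close> times the integral equals
  \<open>m\<close> times the integral.\<close>

lemma gaussian_harmonics_orthogonal:
  assumes "Y \<in> harmonics k" "Z \<in> harmonics m" "k \<noteq> m"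
  shows "(\<integral>x. gaussian x * (Y x * Z x) \<partial>lborel) = 0"
proof -
  have "real k * (\<integral>x. gaussian x * (Y x * Z x) \<partial>lborel) = real m * (\<integral>x. gaussian x * (Y x * Z x) \<partial>lborel)"
    using gaussian_dirichlet[OF assms(1,2)] gaussian_dirichlet[OF assms(2,1)] by (simp add: mult.commute)
  with \<open>k \<noteq> m\<close> show ?thesis by simp
qed

section \<open>From Gaussian integrals to surface integrals\<close>

lemma integrable_surface_measure:
  fixes p :: "'a::euclidean_space \<Rightarrow> real"
  assumes "continuous_on UNIV p"
  shows "integrable surface_measure p"
proof -
  interpret finite_measure "surface_measure :: 'a measure" by (rule finite_measure_surface_measure)
  have "compact (p ` sphere 0 1)"
    using assms by (intro compact_continuous_image) (auto intro: continuous_on_subset)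
  then obtain B where B: "\<And>x. x \<in> sphere 0 1 \<Longrightarrow> norm (p x) \<le> B"
    by (metis compact_imp_bounded bounded_iff imageI)
  show ?thesis
    using AE_surface_measure B borel_measurable_continuous_onI[OF assms]
    by (intro integrable_const_bound[of _ B]) (auto elim!: eventually_mono)
qed

lemma homogeneous_radial:
  assumes "p \<in> homogeneous_polys m"
  shows "p x = norm x ^ m * p (sgn x)"
proof -
  have "x = norm x *\<^sub>R sgn x" by (cases "x = 0") (simp_all add: sgn_div_norm)
  then show ?thesis using homogeneous_scaleR[OF assms, of "norm x" "sgn x"] by simp
qed

text \<open>For \<open>p\<close> homogeneous of degree \<open>m\<close> the Gaussian integral
  separates into the surface integral of \<open>p\<close> and a radial integral that depends only on
  \<open>m\<close> and the dimension; the latter is \<open>C\<close>.\<close>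

lemma gaussian_polar:
  "\<exists>C. C \<noteq> 0 \<and> (\<forall>p \<in> homogeneous_polys m :: ('a::euclidean_space \<Rightarrow> real) set.
      (\<integral>x. gaussian x * p x \<partial>lborel) = C * integral\<^sup>L surface_measure p)"
proof -
  obtain c where c: "c > 0" "\<And>x::'a. gaussian x = c * std_normal_density (norm x)"
    using gaussian_radial by blast
  let ?f = "\<lambda>r::real. c * std_normal_density r * r ^ m"
  let ?w = "radial_density DIM('a)"
  have nonneg: "0 \<le> ?w r * ?f r" for r
    using c by (auto simp: radial_density_def)
  have int: "integrable lborel (\<lambda>r. ?w r * ?f r)"
  proof (rule Bochner_Integration.integrable_bound)
    show "integrable lborel (\<lambda>r. c * (std_normal_density r * \<bar>r\<bar> ^ (DIM('a) - 1 + m)))"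
      by (intro integrable_mult_right integrable_std_normal_moment_abs)
    show "AE r in lborel. norm (?w r * ?f r) \<le> norm (c * (std_normal_density r * \<bar>r\<bar> ^ (DIM('a) - 1 + m)))"
      unfolding power_add using c by (intro AE_I2) (auto simp: radial_density_def abs_mult)
  qed measurable
  define C where "C = (\<integral>r. ?w r * ?f r \<partial>lborel)"
  have "C \<noteq> 0"
  proof
    assume "C = 0"
    then have "AE r in lborel. ?w r * ?f r = 0"
      using integral_nonneg_eq_0_iff_AE[OF int] nonneg by (simp add: C_def)
    \<comment> \<open>The integrand is positive at every \<open>r > 0\<close>, so its vanishing
      almost everywhere would make the interval a null set.\<close>
    then have "AE r in lborel. r \<notin> {0<..<1::real}"
    proof eventually_elim
      case (elim r)
      have "?w r * ?f r > 0" if "0 < r"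
        using that c by (auto simp: radial_density_def intro!: mult_pos_pos normal_density_pos)
      with elim show ?case by auto
    qed
    then have "emeasure lborel {0<..<1::real} = 0"
      using AE_iff_measurable[of "{0<..<1::real}" lborel "\<lambda>r. r \<notin> {0<..<1}"]
      by (simp del: greaterThanLessThan_iff)
    then show False by simp
  qed
  moreover have "(\<integral>x. gaussian x * p x \<partial>lborel) = C * integral\<^sup>L surface_measure p"
    if p: "p \<in> homogeneous_polys m" for p :: "'a \<Rightarrow> real"
  proof -
    have "continuous_on UNIV p"
      using p homogeneous_degree_le continuous_on_degree_le by blast
    from polar_integral[OF _ int integrable_surface_measure[OF this]]
    have "(\<integral>x. ?f (norm x) * p (sgn x) \<partial>lborel) = C * integral\<^sup>L surface_measure p"
      by (auto simp: has_bochner_integral_iff C_def)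
    also have "(\<lambda>x::'a. ?f (norm x) * p (sgn x)) = (\<lambda>x. gaussian x * p x)"
    proof
      fix x :: 'a
      show "?f (norm x) * p (sgn x) = gaussian x * p x"
        unfolding c(2) homogeneous_radial[OF p, of x] by (simp add: mult_ac)
    qed
    finally show ?thesis .
  qed
  ultimately show ?thesis by blast
qed

lemma surface_harmonics_orthogonal:
  fixes Y Z :: "'a::euclidean_space \<Rightarrow> real"
  assumes Y: "Y \<in> harmonics k" and Z: "Z \<in> harmonics m" and "k \<noteq> m"
  shows "(\<integral>\<xi>. Y \<xi> * Z \<xi> \<partial>surface_measure) = 0"
proof -
  obtain C where C: "C \<noteq> 0" "\<And>p :: 'a \<Rightarrow> real. p \<in> homogeneous_polys (k + m) \<Longrightarrow>
      (\<integral>x. gaussian x * p x \<partial>lborel) = C * integral\<^sup>L surface_measure p"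
    using gaussian_polar[of "k + m"] by blast
  have "(\<lambda>x. Y x * Z x) \<in> homogeneous_polys (k + m)"
    using Y Z by (intro homogeneous_mult) (auto simp: harmonics_def)
  from C(2)[OF this] gaussian_harmonics_orthogonal[OF assms] C(1) show ?thesis by simp
qed

lemma sphere_area_eq: "sphere_area TYPE('a::euclidean_space) = measure (surface_measure :: 'a measure) UNIV"
  unfolding sphere_area_def
  using AE_surface_measure[where ?'a = 'a]
  by (intro finite_measure.finite_measure_eq_AE[OF finite_measure_surface_measure]) auto

lemma sphere_area_pos: "sphere_area TYPE('a::euclidean_space) > 0"
proof -
  have "ball 0 1 = {x::'a. norm x < 1 \<and> sgn x \<in> UNIV}" by auto
  then have "emeasure (surface_measure :: 'a measure) UNIV \<noteq> 0"
    using emeasure_surface_measure[of "UNIV :: 'a set"] content_ball_pos[of 1 "0::'a"]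
    by (auto simp: emeasure_eq_measure2 measure_def)
  then show ?thesis
    unfolding sphere_area_eq
    by (simp add: finite_measure.emeasure_eq_measure[OF finite_measure_surface_measure] zero_less_measure_iff)
qed

lemma sphere_inner_surface:
  fixes f g :: "'a::euclidean_space \<Rightarrow> real"
  assumes "continuous_on UNIV f" "continuous_on UNIV g"
  shows "(\<integral>\<xi>. f \<xi> * g \<xi> \<partial>surface_measure) = sphere_area TYPE('a) * sphere_inner f g"
proof -
  have m: "(\<lambda>\<xi>. f \<xi> * g \<xi>) \<in> borel_measurable borel"
    using assms by (intro borel_measurable_continuous_onI continuous_intros)
  have "(LINT \<xi>:sphere 0 1|surface_measure. f \<xi> * g \<xi>) = (\<integral>\<xi>. f \<xi> * g \<xi> \<partial>surface_measure)"
    unfolding set_lebesgue_integral_def using AE_surface_measure m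
  proof (intro integral_cong_AE)
    have "(\<lambda>\<xi>. indicat_real (sphere 0 1) \<xi> *\<^sub>R (f \<xi> * g \<xi>)) \<in> borel_measurable borel"
      using m by (intro borel_measurable_scaleR borel_measurable_indicator) auto
    then show "(\<lambda>\<xi>. indicat_real (sphere 0 1) \<xi> *\<^sub>R (f \<xi> * g \<xi>)) \<in> borel_measurable surface_measure"
      by simp
  qed (use m in \<open>auto elim!: eventually_mono\<close>)
  then show ?thesis using sphere_area_pos[where ?'a = 'a] by (simp add: sphere_inner_def)
qed

section \<open>Orthogonal systems of polynomials\<close>

definition polys :: "('a::euclidean_space \<Rightarrow> real) set" where
  "polys = span (range monomial)"

lemma degree_le_polys: "polys_degree_le n \<subseteq> polys"
  unfolding polys_degree_le_def polys_def by (rule span_mono) auto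

lemma polys_mult: "p \<in> polys \<Longrightarrow> q \<in> polys \<Longrightarrow> (\<lambda>x. p x * q x) \<in> polys"
  unfolding polys_def by (rule span_mult) (auto simp: monomial_mult intro!: span_base)

section \<open>Symmetric bilinear forms on function spaces\<close>

lemma span_compose:
  fixes f :: "'b \<Rightarrow> real"
  assumes "f \<in> span A"
  shows "(\<lambda>x. f (h x)) \<in> span ((\<lambda>g x. g (h x)) ` A)"
  using assms
proof (induction rule: fun_span_induct)
  case (base f)
  then show ?case by (intro span_base) auto
qed (auto intro: fun_zero_in_span fun_add_in_span fun_scale_in_span)

text \<open>Bilinearity is required only on \<open>V\<close>: the integral of a function that is not
  integrable is \<open>0\<close> by convention, so additivity of a weighted inner product can fail
  outside the polynomials. Nonzero squared norms enter as hypotheses of single lemmas, since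
  definiteness depends on the weight.\<close>

locale symmetric_bilinear =
  fixes ip :: "('a \<Rightarrow> real) \<Rightarrow> ('a \<Rightarrow> real) \<Rightarrow> real" and V :: "('a \<Rightarrow> real) set"
  assumes subspace_V: "subspace V"
    and ip_add: "\<And>f g h. f \<in> V \<Longrightarrow> g \<in> V \<Longrightarrow> h \<in> V \<Longrightarrow> ip (\<lambda>x. f x + g x) h = ip f h + ip g h"
    and ip_scale: "\<And>c f h. f \<in> V \<Longrightarrow> h \<in> V \<Longrightarrow> ip (\<lambda>x. c * f x) h = c * ip f h"
    and ip_sym: "\<And>f g. ip f g = ip g f"
begin

lemma zero_in_V: "(\<lambda>x. 0) \<in> V"
  using subspace_0[OF subspace_V] by (simp add: zero_fun_def)

lemma ip_zero: "f \<in> V \<Longrightarrow> ip (\<lambda>x. 0) f = 0"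
  using ip_scale[OF zero_in_V, of f 0] by simp

lemma span_in_V: "A \<subseteq> V \<Longrightarrow> span A \<subseteq> V"
  by (rule span_minimal[OF _ subspace_V])

lemma ip_sum:
  assumes "\<And>i. i \<in> A \<Longrightarrow> f i \<in> V" "h \<in> V"
  shows "ip (\<lambda>x. \<Sum>i\<in>A. c i * f i x) h = (\<Sum>i\<in>A. c i * ip (f i) h)"
  using assms(1)
proof (induction A rule: infinite_finite_induct)
  case (insert a A)
  have "(\<lambda>x. c a * f a x) \<in> V"
    using insert subspace_scale[OF subspace_V, of "f a" "c a"] by (simp add: scaleR_fun_def)
  moreover have "(\<lambda>x. \<Sum>i\<in>A. c i * f i x) \<in> V"
  proof -
    have "span (f ` A) \<subseteq> V" using insert by (intro span_in_V) auto
    moreover have "(\<lambda>x. \<Sum>i\<in>A. c i * f i x) \<in> span (f ` A)"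
      by (intro fun_sum_in_span fun_scale_in_span span_base) auto
    ultimately show ?thesis by blast
  qed
  ultimately show ?case using insert assms(2) by (simp add: ip_add ip_scale)
qed (use assms ip_zero in auto)

lemma orthogonal_span:
  assumes "f \<in> span A" "A \<subseteq> V" "g \<in> V" "\<And>a. a \<in> A \<Longrightarrow> ip a g = 0"
  shows "ip f g = 0"
  using assms(1)
proof (induction rule: fun_span_induct)
  case (add f h)
  then have "f \<in> V" "h \<in> V" using span_in_V assms(2) by auto
  with add assms(3) show ?case using ip_add[of f h g] by simp
next
  case (scale c f)
  then have "f \<in> V" using span_in_V assms(2) by auto
  with scale assms(3) show ?case using ip_scale[of f g c] by simp
qed (use assms ip_zero in auto)

text \<open>The coefficients are linear in \<open>f\<close>, so the identity passes from the members
  \<open>q j\<close>, where orthogonality leaves a single term, to their span.\<close>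

lemma orthogonal_expansion:
  assumes J: "finite J" "\<And>i. i \<in> J \<Longrightarrow> q i \<in> V"
    and orth: "\<And>i j. i \<in> J \<Longrightarrow> j \<in> J \<Longrightarrow> i \<noteq> j \<Longrightarrow> ip (q i) (q j) = 0"
    and nz: "\<And>i. i \<in> J \<Longrightarrow> ip (q i) (q i) \<noteq> 0"
    and f: "f \<in> span (q ` J)"
  shows "f = (\<lambda>x. \<Sum>i\<in>J. ip f (q i) / ip (q i) (q i) * q i x)"
proof -
  have sV: "span (q ` J) \<subseteq> V" using J by (intro span_in_V) auto
  show ?thesis
    using f
  proof (induction rule: fun_span_induct)
    case (base f)
    then obtain j where j: "j \<in> J" "f = q j" by auto
    have "(\<Sum>i\<in>J. ip f (q i) / ip (q i) (q i) * q i x) = (\<Sum>i\<in>J. if i = j then q i x else 0)" for x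
      using j orth nz by (intro sum.cong) auto
    then show ?case using J j by (simp add: sum.delta)
  next
    case zero
    then show ?case using J by (simp add: ip_zero)
  next
    case (add f h)
    then have V: "f \<in> V" "h \<in> V" using sV by blast+
    show ?case
    proof
      fix x
      have "f x + h x = (\<Sum>i\<in>J. ip f (q i) / ip (q i) (q i) * q i x) + (\<Sum>i\<in>J. ip h (q i) / ip (q i) (q i) * q i x)"
        by (rule arg_cong2[where f = "(+)", OF fun_cong[OF add(3)] fun_cong[OF add(4)]])
      also have "\<dots> = (\<Sum>i\<in>J. ip (\<lambda>x. f x + h x) (q i) / ip (q i) (q i) * q i x)"
        unfolding sum.distrib[symmetric] using V J
        by (intro sum.cong) (auto simp: ip_add add_divide_distrib distrib_right)
      finally show "f x + h x = (\<Sum>i\<in>J. ip (\<lambda>x. f x + h x) (q i) / ip (q i) (q i) * q i x)" .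
    qed
  next
    case (scale c f)
    then have V: "f \<in> V" using sV by blast
    show ?case
    proof
      fix x
      have "c * f x = (\<Sum>i\<in>J. c * (ip f (q i) / ip (q i) (q i) * q i x))"
        unfolding sum_distrib_left[symmetric] by (rule arg_cong[OF fun_cong[OF scale(2)]])
      also have "\<dots> = (\<Sum>i\<in>J. ip (\<lambda>x. c * f x) (q i) / ip (q i) (q i) * q i x)"
        using V J by (intro sum.cong) (auto simp: ip_scale)
      finally show "c * f x = (\<Sum>i\<in>J. ip (\<lambda>x. c * f x) (q i) / ip (q i) (q i) * q i x)" .
    qed
  qed
qed

text \<open>A repeated member, or one in the span of the others, would be orthogonal to
  itself.\<close>

lemma orthogonal_inj_independent:
  assumes J: "finite J" "\<And>i. i \<in> J \<Longrightarrow> q i \<in> V"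
    and orth: "\<And>i j. i \<in> J \<Longrightarrow> j \<in> J \<Longrightarrow> i \<noteq> j \<Longrightarrow> ip (q i) (q j) = 0"
    and nz: "\<And>i. i \<in> J \<Longrightarrow> ip (q i) (q i) \<noteq> 0"
  shows "inj_on q J" "independent (q ` J)"
proof -
  show inj: "inj_on q J"
    using orth nz by (intro inj_onI) metis
  show "independent (q ` J)"
    unfolding dependent_def
  proof safe
    fix i assume i: "i \<in> J" "q i \<in> span (q ` J - {q i})"
    have "q ` J - {q i} = q ` (J - {i})"
      using inj i by (auto dest: inj_onD)
    with i have "q i \<in> span (q ` (J - {i}))" by simp
    then have "ip (q i) (q i) = 0"
      using J orth i by (intro orthogonal_span[of "q i" "q ` (J - {i})"]) auto
    with nz i show False by blast
  qed
qed

end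

lemma set_integral_indicator: "(LINT z:D|M. f z) = (\<integral>z. f z * indicator D z \<partial>M)" for f :: "_ \<Rightarrow> real"
  by (simp add: set_lebesgue_integral_def mult.commute)

lemma symmetric_bilinear_weighted_inner:
  fixes U :: "'a::euclidean_space \<Rightarrow> real"
  assumes "\<And>p. p \<in> polys \<Longrightarrow> set_integrable lebesgue D (\<lambda>z. p z * U z)"
  shows "symmetric_bilinear (weighted_inner U D) polys"
proof
  show "subspace (polys :: ('a \<Rightarrow> real) set)" by (simp add: polys_def)
  fix f g h :: "'a \<Rightarrow> real" and c :: real
  show "weighted_inner U D f g = weighted_inner U D g f"
    by (simp add: weighted_inner_def mult.commute)
  have i: "set_integrable lebesgue D (\<lambda>z. p z * q z * U z)" if "p \<in> polys" "q \<in> polys" for p q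
    using assms[OF polys_mult[OF that]] .
  show "weighted_inner U D (\<lambda>x. f x + g x) h = weighted_inner U D f h + weighted_inner U D g h"
    if "f \<in> polys" "g \<in> polys" "h \<in> polys"
    using set_integral_add(2)[OF i[OF that(1,3)] i[OF that(2,3)]]
    by (simp add: weighted_inner_def distrib_right)
  show "weighted_inner U D (\<lambda>x. c * f x) h = c * weighted_inner U D f h"
    by (simp add: weighted_inner_def mult.assoc)
qed

section \<open>Polynomials in the plane\<close>

lemma Basis_real_real: "Basis = {(1, 0), (0, 1) :: real \<times> real}"
  by (auto simp: Basis_prod_def)

lemma monomial_plane: "monomial \<alpha> (s, t) = s ^ \<alpha> (1, 0) * t ^ \<alpha> (0, 1)"
  by (simp add: monomial_def Basis_real_real)

lemma sum_Basis_plane: "(\<Sum>b\<in>Basis. \<alpha> b) = \<alpha> (1, 0) + (\<alpha> (0, 1) :: nat)" for \<alpha> :: "real \<times> real \<Rightarrow> nat"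
  by (simp add: Basis_real_real)

lemma power_plane_degree_le:
  assumes "a + b \<le> n"
  shows "(\<lambda>z::real \<times> real. fst z ^ a * snd z ^ b) \<in> polys_degree_le n"
proof -
  define \<alpha> :: "real \<times> real \<Rightarrow> nat" where "\<alpha> u = (if u = (1, 0) then a else b)" for u
  have "(\<lambda>z::real \<times> real. fst z ^ a * snd z ^ b) = monomial \<alpha>"
    by (auto simp: fun_eq_iff monomial_plane \<alpha>_def)
  then show ?thesis
    using assms monomial_degree_le[of \<alpha> n] by (simp add: sum_Basis_plane \<alpha>_def)
qed

definition reflect :: "real \<times> real \<Rightarrow> real \<times> real" where
  "reflect z = (- fst z, snd z)"

lemma degree_le_reflect:
  assumes "p \<in> polys_degree_le n"
  shows "(\<lambda>z. p (reflect z)) \<in> polys_degree_le n"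
  using assms unfolding polys_degree_le_def
proof (induction rule: fun_span_induct)
  case (base f)
  then obtain \<alpha> where \<alpha>: "f = monomial \<alpha>" "(\<Sum>b\<in>Basis. \<alpha> b) \<le> n" by auto
  have "f (reflect (s, t)) = (-1) ^ \<alpha> (1, 0) * monomial \<alpha> (s, t)" for s t
    using power_minus[of s "\<alpha> (1,0)"] by (simp add: \<alpha> monomial_plane reflect_def)
  then have "(\<lambda>z. f (reflect z)) = (\<lambda>z. (-1) ^ \<alpha> (1, 0) * monomial \<alpha> z)" by auto
  then show ?case using monomial_degree_le[OF \<alpha>(2)] by (auto simp: polys_degree_le_def intro: fun_scale_in_span)
qed (auto intro: fun_zero_in_span fun_add_in_span fun_scale_in_span)

text \<open>The coefficients of \<open>Q\<close> are polynomials in \<open>t\<close>; it is evaluated at the constant polynomial \<open>s\<close> first.\<close>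

lemma plane_poly_as_poly:
  fixes p :: "real \<times> real \<Rightarrow> real"
  assumes "p \<in> polys"
  shows "\<exists>Q :: real poly poly. \<forall>s t. p (s, t) = poly (poly Q [:s:]) t"
  using assms unfolding polys_def
proof (induction rule: fun_span_induct)
  case (base f)
  then obtain \<alpha> where \<alpha>: "f = monomial \<alpha>" by auto
  have "f (s, t) = poly (poly (monom (monom 1 (\<alpha> (0, 1))) (\<alpha> (1, 0))) [:s:]) t" for s t
    by (simp add: \<alpha> monomial_plane poly_monom)
  then show ?case by blast
next
  case zero
  show ?case by (rule exI[of _ 0]) simp
next
  case (add f g)
  then obtain Q R where "\<forall>s t. f (s, t) = poly (poly Q [:s:]) t" "\<forall>s t. g (s, t) = poly (poly R [:s:]) t"
    by blast
  then show ?case by (intro exI[of _ "Q + R"]) simp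
next
  case (scale c f)
  then obtain Q where "\<forall>s t. f (s, t) = poly (poly Q [:s:]) t"
    by blast
  then show ?case by (intro exI[of _ "smult [:c:] Q"]) simp
qed

lemma polys_measurable:
  assumes "p \<in> polys"
  shows "p \<in> borel_measurable borel" "continuous_on A p"
proof -
  show "continuous_on A p" for A
    using assms unfolding polys_def
  proof (induction rule: fun_span_induct)
    case (base f)
    then show ?case by (auto simp: monomial_def[abs_def] intro!: continuous_intros)
  qed (auto intro!: continuous_intros)
  then show "p \<in> borel_measurable borel" by (intro borel_measurable_continuous_onI)
qed

text \<open>For all but finitely many \<open>s\<close> the section of \<open>p\<close> at
  \<open>s\<close> is a nonzero polynomial in \<open>t\<close> with finitely many roots; thus almost
  every section of the zero set is null, and Fubini's theorem applies.\<close>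

lemma AE_plane_poly_nonzero:
  fixes p :: "real \<times> real \<Rightarrow> real"
  assumes p: "p \<in> polys" and "p \<noteq> (\<lambda>_. 0)"
  shows "AE z in lborel. p z \<noteq> 0"
proof -
  obtain Q :: "real poly poly" where Q: "\<And>s t. p (s, t) = poly (poly Q [:s:]) t"
    using plane_poly_as_poly[OF p] by blast
  have "Q \<noteq> 0"
  proof
    assume "Q = 0"
    then have "p (s, t) = 0" for s t using Q by simp
    then have "p z = 0" for z by (cases z) simp
    with assms(2) show False by blast
  qed
  have fin: "AE s in lborel. s \<notin> A" if "finite A" for A :: "real set"
    using finite_imp_null_set_lborel[OF that] by (rule AE_not_in)
  \<comment> \<open>\<open>Q\<close> has finitely many roots in the ring of polynomials in
    \<open>t\<close>, hence finitely many among the constants \<open>[:s:]\<close>.\<close>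
  have "finite {s :: real. poly Q [:s:] = 0}"
    using finite_vimageI[OF poly_roots_finite[OF \<open>Q \<noteq> 0\<close>], of "\<lambda>s. [:s:]"]
    by (auto simp: inj_def vimage_def)
  from fin[OF this] have "AE s in lborel. AE t in lborel. p (s, t) \<noteq> 0"
  proof eventually_elim
    case (elim s)
    then have "finite {t. poly (poly Q [:s:]) t = 0}" by (intro poly_roots_finite) auto
    from fin[OF this] show ?case by eventually_elim (simp add: Q)
  qed
  moreover have "{z \<in> space (lborel \<Otimes>\<^sub>M lborel). p z \<noteq> 0} \<in> sets (lborel \<Otimes>\<^sub>M lborel)"
  proof -
    have "p -` (- {0}) \<inter> space borel \<in> sets borel"
      by (intro measurable_sets[OF polys_measurable(1)[OF p]]) auto
    then show ?thesis unfolding lborel_prod by (simp add: vimage_def)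
  qed
  ultimately have "AE z in lborel \<Otimes>\<^sub>M lborel. p z \<noteq> 0"
    by (intro lborel_pair.AE_pair_measure)
  then show ?thesis unfolding lborel_prod .
qed

section \<open>Parity of integrals\<close>

text \<open>Together with \<open>const_harmonic\<close>, this makes the vanishing of the integral of
  the sign over \<open>{-1, 1}\<close> a case of the orthogonality of harmonics of degrees one and
  zero.\<close>

lemma identity_harmonic: "(\<lambda>x::real. x) \<in> harmonics 1"
proof -
  have "deriv ((+) x) = (\<lambda>_. 1)" for x :: real
    by (auto intro!: DERIV_imp_deriv derivative_eq_intros)
  then show ?thesis
    using coord_homogeneous[of "1::real"]
    by (simp add: harmonics_def laplacian_def numeral_2_eq_2)
qed

lemma const_harmonic: "(\<lambda>x. c) \<in> harmonics 0"
  by (simp add: harmonics_def const_homogeneous laplacian_def numeral_2_eq_2)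

text \<open>On the real line polar coordinates are \<open>s = \<bar>s\<bar> * sgn s\<close>, so integrals of odd and even functions
  are computed by the same formula as on the domain of revolution.\<close>

lemma surface_measure_real:
  "(\<integral>\<xi>. \<xi> \<partial>(surface_measure :: real measure)) = 0" "(\<integral>\<xi>. (1::real) \<partial>(surface_measure :: real measure)) = 2"
proof -
  show "(\<integral>\<xi>. \<xi> \<partial>(surface_measure :: real measure)) = 0"
    using surface_harmonics_orthogonal[OF identity_harmonic const_harmonic[of 1]] by simp
  have "{x::real. norm x < 1} = {-1<..<1}" by auto
  then show "(\<integral>\<xi>. (1::real) \<partial>(surface_measure :: real measure)) = 2"
    by (simp add: measure_def emeasure_surface_measure)
qed

lemma
  fixes F :: "real \<times> real \<Rightarrow> real"
  assumes "integrable lebesgue F"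
  shows integral_odd: "(\<And>z. F (reflect z) = - F z) \<Longrightarrow> integral\<^sup>L lebesgue F = 0"
    and integral_even: "(\<And>z. F (reflect z) = F z) \<Longrightarrow>
      (\<integral>z. F z * indicator {0..} (fst z) \<partial>lebesgue) = integral\<^sup>L lebesgue F / 2"
proof -
  \<comment> \<open>In dimension one the radial density is an indicator, so the cylindrical formula
    integrates over exactly the right half plane.\<close>
  have w: "radial_density DIM(real) s = indicator {0..} s" for s
    by (simp add: radial_density_def indicator_def)
  have "(\<lambda>z::real \<times> real. indicator {0..} (fst z) :: real) \<in> borel_measurable borel"
    using radial_density_fst_measurable[of "DIM(real)"] unfolding w .
  then have int: "integrable lebesgue (\<lambda>z. radial_density DIM(real) (fst z) * F z)"
    unfolding w using assms
    by (intro Bochner_Integration.integrable_bound[OF assms] borel_measurable_times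
        borel_measurable_integrable[OF assms])
       (auto simp: measurable_completion indicator_def)
  have id: "integrable (surface_measure :: real measure) (\<lambda>\<xi>. \<xi>)"
    and one: "integrable (surface_measure :: real measure) (\<lambda>\<xi>. 1 :: real)"
    by (intro integrable_surface_measure continuous_intros)+
  have abs: "F (\<bar>fst z\<bar>, snd z) = (if fst z < 0 then F (reflect z) else F z)" for z
    by (simp add: reflect_def)
  show "integral\<^sup>L lebesgue F = 0" if odd: "\<And>z. F (reflect z) = - F z"
  proof -
    \<comment> \<open>Off the axis \<open>fst z = 0\<close> an odd function is its value at the
      reflected radius times the sign, and the sign integrates to \<open>0\<close> over
      \<open>{-1, 1}\<close>.\<close>
    have "AE z in lborel. F (norm (fst z), snd z) * sgn (fst z) = F z"
      using AE_lborel_fst_nonzero[where ?'a = real and ?'b = real]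
      by eventually_elim (auto simp: abs odd sgn_if)
    from AE_completion[OF this]
    have "(\<integral>z. F (norm (fst z), snd z) * sgn (fst z) \<partial>lebesgue) = integral\<^sup>L lebesgue F"
      using cylindrical_integral[OF int id] assms
      by (intro integral_cong_AE) (auto simp: has_bochner_integral_iff)
    then show ?thesis
      using cylindrical_integral[OF int id] surface_measure_real by (simp add: has_bochner_integral_iff)
  qed
  show "(\<integral>z. F z * indicator {0..} (fst z) \<partial>lebesgue) = integral\<^sup>L lebesgue F / 2"
    if even: "\<And>z. F (reflect z) = F z"
  proof -
    have "F (norm (fst z), snd z) = F z" for z by (simp add: abs even)
    with cylindrical_integral[OF int one] surface_measure_real show ?thesis
      by (simp add: has_bochner_integral_iff w[simplified] mult.commute)
  qed
qed

section \<open>The weight in the plane\<close>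

locale even_weighted_domain =
  fixes \<Omega> :: "(real \<times> real) set" and W :: "real \<times> real \<Rightarrow> real"
  assumes domain_measurable: "\<Omega> \<in> sets lebesgue"
    and domain_symmetric: "\<And>s t. (s, t) \<in> \<Omega> \<longleftrightarrow> (- s, t) \<in> \<Omega>"
    and even_weight: "even_weight W \<Omega>"
begin

text \<open>Nothing is known of \<open>W\<close> outside \<open>\<Omega>\<close>. Multiplied by the
  indicator it is nonnegative, even and Lebesgue measurable on the whole plane, and set integrals
  become integrals over the plane.\<close>

definition wt :: "real \<times> real \<Rightarrow> real" where
  "wt z = indicator \<Omega> z * W z"

lemma wt_nonneg: "0 \<le> wt z"
  using even_weight by (cases z) (auto simp: wt_def even_weight_def indicator_def)

lemma wt_reflect: "wt (reflect z) = wt z"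
  using even_weight domain_symmetric
  by (cases z) (auto simp: wt_def even_weight_def indicator_def reflect_def)

lemma integrable_moment: "integrable lebesgue (\<lambda>z. fst z ^ a * snd z ^ b * wt z)"
proof -
  have "set_integrable lebesgue \<Omega> (\<lambda>(s, t). s ^ a * t ^ b * W (s, t))"
    using even_weight by (simp add: even_weight_def)
  then show ?thesis
    by (simp add: set_integrable_def wt_def case_prod_unfold mult_ac)
qed

lemma wt_measurable: "wt \<in> borel_measurable lebesgue"
  using borel_measurable_integrable[OF integrable_moment[of 0 0]] by simp

text \<open>On monomials the integrand is dominated by a moment of the weight. The multiplier
  \<open>w\<close> stands for the powers of \<open>\<bar>fst z\<bar>\<close> in the lifted weights,
  and for the radial density times a power of the radius.\<close>

lemma integrable_poly_wt:
  assumes w: "w \<in> borel_measurable borel" "\<And>z. \<bar>w z\<bar> \<le> \<bar>fst z\<bar> ^ c" and p: "p \<in> polys"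
  shows "integrable lebesgue (\<lambda>z. w z * p z * wt z)"
  using p unfolding polys_def
proof (induction rule: fun_span_induct)
  case (base f)
  then obtain \<alpha> where f: "f = monomial \<alpha>" by auto
  have "f \<in> polys" using base by (auto simp: polys_def intro: span_base)
  then have m: "(\<lambda>z. w z * f z) \<in> borel_measurable lebesgue"
    using polys_measurable(1) w by (intro measurable_completion borel_measurable_times) auto
  show ?case
  proof (rule Bochner_Integration.integrable_bound)
    show "integrable lebesgue (\<lambda>z. fst z ^ (c + \<alpha> (1, 0)) * snd z ^ \<alpha> (0, 1) * wt z)"
      by (rule integrable_moment)
    show "(\<lambda>z. w z * f z * wt z) \<in> borel_measurable lebesgue"
      by (intro borel_measurable_times m wt_measurable)
    show "AE z in lebesgue. norm (w z * f z * wt z)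
        \<le> norm (fst z ^ (c + \<alpha> (1, 0)) * snd z ^ \<alpha> (0, 1) * wt z)"
    proof (intro AE_I2)
      fix z :: "real \<times> real"
      have "\<bar>w z\<bar> * \<bar>f z * wt z\<bar> \<le> \<bar>fst z\<bar> ^ c * \<bar>f z * wt z\<bar>"
        using w(2) by (rule mult_right_mono) simp
      then show "norm (w z * f z * wt z) \<le> norm (fst z ^ (c + \<alpha> (1, 0)) * snd z ^ \<alpha> (0, 1) * wt z)"
        by (cases z) (simp add: f monomial_plane abs_mult power_add power_abs mult_ac)
    qed
  qed
next
  case (add f g)
  from Bochner_Integration.integrable_add[OF add(3,4)] show ?case by (simp add: algebra_simps)
next
  case (scale c f)
  from integrable_mult_right[OF scale(2), of c] show ?case by (simp add: mult_ac)
qed simp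

lemma abs_power_measurable: "(\<lambda>z::real \<times> real. \<bar>fst z\<bar> ^ c) \<in> borel_measurable borel"
  by (intro borel_measurable_continuous_onI continuous_intros)

lemma integrable_abs_power_poly: "p \<in> polys \<Longrightarrow> integrable lebesgue (\<lambda>z. \<bar>fst z\<bar> ^ c * p z * wt z)"
  by (rule integrable_poly_wt[OF abs_power_measurable, where c = c]) auto

lemma weighted_inner_lifted:
  "weighted_inner (lifted_weight d W k) \<Omega> p q =
     (\<integral>z. \<bar>fst z\<bar> ^ (k + d - 1) * (p z * q z) * wt z \<partial>lebesgue)"
  unfolding weighted_inner_def lifted_weight_def set_integral_indicator wt_def
  by (simp add: case_prod_unfold mult_ac)

lemma lifted_poly_integrable:
  assumes "p \<in> polys"
  shows "set_integrable lebesgue \<Omega> (\<lambda>z. p z * lifted_weight d W k z)"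
  using integrable_abs_power_poly[OF assms, of "k + d - 1"]
  by (simp add: set_integrable_def lifted_weight_def wt_def case_prod_unfold mult_ac)

text \<open>The integrand is nonnegative, hence zero almost everywhere; a nonzero polynomial and
  \<open>fst z\<close> vanish only on null sets, which would leave \<open>wt\<close> zero almost
  everywhere.\<close>

lemma weighted_inner_lifted_definite:
  assumes p: "p \<in> polys" and nz: "\<not> (AE z in lebesgue. wt z = 0)"
    and 0: "weighted_inner (lifted_weight d W k) \<Omega> p p = 0"
  shows "p = (\<lambda>_. 0)"
proof (rule ccontr)
  assume "p \<noteq> (\<lambda>_. 0)"
  have int: "integrable lebesgue (\<lambda>z. \<bar>fst z\<bar> ^ (k + d - 1) * (p z * p z) * wt z)"
    by (rule integrable_abs_power_poly[OF polys_mult[OF p p]])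
  have "AE z in lebesgue. \<bar>fst z\<bar> ^ (k + d - 1) * (p z * p z) * wt z = 0"
    using 0 integral_nonneg_eq_0_iff_AE[OF int] by (simp add: weighted_inner_lifted wt_nonneg)
  moreover have "AE z in lebesgue. p z \<noteq> 0"
    by (rule AE_completion[OF AE_plane_poly_nonzero[OF p \<open>p \<noteq> _\<close>]])
  moreover have "AE z::real \<times> real in lebesgue. fst z \<noteq> 0"
    by (rule AE_completion[OF AE_lborel_fst_nonzero])
  ultimately have "AE z in lebesgue. wt z = 0"
    by eventually_elim auto
  with nz show False by blast
qed

lemma weighted_inner_lifted_odd:
  assumes "p \<in> polys" "q \<in> polys" "\<And>z. p (reflect z) = p z" "\<And>z. q (reflect z) = - q z"
  shows "weighted_inner (lifted_weight d W k) \<Omega> p q = 0"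
  unfolding weighted_inner_lifted
proof (rule integral_odd)
  show "integrable lebesgue (\<lambda>z. \<bar>fst z\<bar> ^ (k + d - 1) * (p z * q z) * wt z)"
    by (rule integrable_abs_power_poly[OF polys_mult[OF assms(1,2)]])
  show "\<bar>fst (reflect z)\<bar> ^ (k + d - 1) * (p (reflect z) * q (reflect z)) * wt (reflect z) =
      - (\<bar>fst z\<bar> ^ (k + d - 1) * (p z * q z) * wt z)" for z
    using assms(3,4)[of z] by (simp add: wt_reflect) (simp add: reflect_def)
qed

end

section \<open>Even orthogonal polynomials in the plane\<close>

lemma orthogonal_basis_memberD: "orthogonal_basis ip V I q \<Longrightarrow> i \<in> I \<Longrightarrow> q i \<in> V"
  by (auto simp: orthogonal_basis_def intro: span_base)

locale even_orthogonal_basis = even_weighted_domain \<Omega> W for \<Omega> W +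
  fixes d k :: nat and P :: "nat \<Rightarrow> nat \<Rightarrow> real \<times> real \<Rightarrow> real"
  assumes basis: "\<And>m. orthogonal_basis (weighted_inner (lifted_weight d W k) \<Omega>)
      (even_orth_polys m (lifted_weight d W k) \<Omega>) {0..m div 2} (P m)"
begin

abbreviation "ip \<equiv> weighted_inner (lifted_weight d W k) \<Omega>"

sublocale symmetric_bilinear ip polys
  by (rule symmetric_bilinear_weighted_inner[OF lifted_poly_integrable])

lemma
  assumes "i \<le> m div 2"
  shows P_degree: "P m i \<in> polys_degree_le m"
    and P_orthogonal_lower: "n < m \<Longrightarrow> f \<in> polys_degree_le n \<Longrightarrow> ip (P m i) f = 0"
    and P_even: "P m i (reflect z) = P m i z"
proof -
  have *: "P m i \<in> even_orth_polys m (lifted_weight d W k) \<Omega>"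
    using orthogonal_basis_memberD[OF basis, of i m] assms by simp
  show "P m i \<in> polys_degree_le m" "n < m \<Longrightarrow> f \<in> polys_degree_le n \<Longrightarrow> ip (P m i) f = 0"
    using * by (auto simp: even_orth_polys_def orth_polys_def)
  have "P m i (fst z, snd z) = P m i (- fst z, snd z)"
    using * unfolding even_orth_polys_def by blast
  then show "P m i (reflect z) = P m i z" by (simp add: reflect_def)
qed

lemma P_polys: "i \<le> m div 2 \<Longrightarrow> P m i \<in> polys"
  using P_degree degree_le_polys by blast

lemma weight_nontrivial: "\<not> (AE z in lebesgue. wt z = 0)"
proof
  assume ae: "AE z in lebesgue. wt z = 0"
  have 0: "ip f g = 0" for f g
    unfolding weighted_inner_lifted
    by (rule integral_eq_zero_AE) (use ae in \<open>auto elim!: eventually_mono\<close>)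
  have "(\<lambda>z::real \<times> real. fst z ^ 0 * snd z ^ 0) \<in> polys_degree_le 1"
    "(\<lambda>z::real \<times> real. fst z ^ 0 * snd z ^ 1) \<in> polys_degree_le 1"
    by (rule power_plane_degree_le, simp)+
  then have "(\<lambda>z. 1) \<in> even_orth_polys 1 (lifted_weight d W k) \<Omega>"
    "snd \<in> even_orth_polys 1 (lifted_weight d W k) \<Omega>"
    by (simp_all add: even_orth_polys_def orth_polys_def 0)
  moreover have "even_orth_polys 1 (lifted_weight d W k) \<Omega> = span {P 1 0}"
    using basis[of 1] by (simp add: orthogonal_basis_def)
  ultimately obtain a b where "(\<lambda>z. 1) = (\<lambda>z. a * P 1 0 z)" and b: "snd = (\<lambda>z. b * P 1 0 z)"
    by (auto simp: span_singleton scaleR_fun_def)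
  \<comment> \<open>At the origin the first equation forces \<open>P 1 0\<close> to be nonzero,
    while \<open>snd\<close> vanishes there; so \<open>b = 0\<close>, against the value of
    \<open>snd\<close> at \<open>(0, 1)\<close>.\<close>
  from fun_cong[OF this(1), of 0] fun_cong[OF this(2), of 0] have "b = 0" by auto
  with fun_cong[OF b, of "(0, 1)"] show False by simp
qed

lemma P_nonzero: "i \<le> m div 2 \<Longrightarrow> ip (P m i) (P m i) \<noteq> 0"
proof
  assume i: "i \<le> m div 2" and "ip (P m i) (P m i) = 0"
  then have "P m i = (\<lambda>_. 0)"
    using weighted_inner_lifted_definite[OF P_polys[OF i] weight_nontrivial] by blast
  moreover have "independent (P m ` {0..m div 2})"
    using basis[of m] by (simp add: orthogonal_basis_def)
  ultimately show False
    using i dependent_zero[of "P m ` {0..m div 2}"] by (force simp: zero_fun_def)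
qed

text \<open>Within one degree this is the choice of basis; for different degrees, the polynomial of
  higher degree is orthogonal to everything of lower degree.\<close>

lemma P_orthogonal:
  assumes "i \<le> m div 2" "j \<le> n div 2" "(m, i) \<noteq> (n, j)"
  shows "ip (P m i) (P n j) = 0"
proof (cases m n rule: linorder_cases)
  case less
  then show ?thesis using P_orthogonal_lower[of j n m] P_degree assms by (simp add: ip_sym[of "P m i"])
next
  case greater
  then show ?thesis using P_orthogonal_lower P_degree assms by simp
next
  case equal
  then show ?thesis using basis[of m] assms by (auto simp: orthogonal_basis_def)
qed

text \<open>Subtracting from \<open>p\<close> its projection \<open>s\<close> to the basis elements
  of degree below \<open>m\<close> leaves an even remainder \<open>r\<close> in
  \<open>even_orth_polys m\<close>, which the given basis of degree \<open>m\<close> spans.\<close>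

lemma even_poly_in_span:
  assumes "p \<in> polys_degree_le m" "\<And>z. p (reflect z) = p z"
  shows "p \<in> span ((\<lambda>(j, i). P j i) ` {(j, i). j \<le> m \<and> i \<le> j div 2})"
  using assms
proof (induction m arbitrary: p rule: less_induct)
  case (less m)
  let ?q = "\<lambda>(j, i). P j i"
  define J where "J = {(j, i). j < m \<and> i \<le> j div 2}"
  have "J \<subseteq> {..m} \<times> {..m}" unfolding J_def by auto
  then have "finite J" by (rule finite_subset) simp
  have JV: "?q x \<in> polys" if "x \<in> J" for x using that P_polys by (auto simp: J_def)
  have qd: "?q x \<in> polys_degree_le m" if "x \<in> J" for x
    using that P_degree degree_le_mono[of "fst x" m] by (force simp: J_def)
  define c where "c x = ip p (?q x) / ip (?q x) (?q x)" for x
  define s where "s = (\<lambda>z. \<Sum>x\<in>J. c x * ?q x z)"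
  define r where "r = (\<lambda>z. p z + (-1) * s z)"
  have pV: "p \<in> polys" using less.prems(1) degree_le_polys by blast
  have s_span: "s \<in> span (?q ` J)"
    unfolding s_def by (intro fun_sum_in_span fun_scale_in_span span_base) auto
  have s_deg: "s \<in> polys_degree_le m"
    unfolding s_def polys_degree_le_def
    by (intro fun_sum_in_span fun_scale_in_span) (use qd in \<open>auto simp: polys_degree_le_def\<close>)
  then have sV: "s \<in> polys" using degree_le_polys by blast
  have r_deg: "r \<in> polys_degree_le m"
    using less.prems(1) s_deg unfolding r_def polys_degree_le_def
    by (intro fun_add_in_span fun_scale_in_span)
  then have rV: "r \<in> polys" using degree_le_polys by blast
  have s_even: "s (reflect z) = s z" for z
    unfolding s_def by (intro sum.cong) (auto simp: J_def P_even)
  then have r_even: "r (reflect z) = r z" for z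
    using less.prems(2) by (simp add: r_def)
  have r_orth: "ip r (?q y) = 0" if y: "y \<in> J" for y
  proof -
    have "ip s (?q y) = (\<Sum>x\<in>J. c x * ip (?q x) (?q y))"
      unfolding s_def using JV y by (intro ip_sum) auto
    also have "\<dots> = (\<Sum>x\<in>J. if x = y then c y * ip (?q y) (?q y) else 0)"
    proof (intro sum.cong refl)
      fix x assume "x \<in> J"
      then show "c x * ip (?q x) (?q y) = (if x = y then c y * ip (?q y) (?q y) else 0)"
        using y P_orthogonal[of "snd x" "fst x" "snd y" "fst y"]
        by (cases x, cases y) (simp add: J_def)
    qed
    also have "\<dots> = ip p (?q y)"
      using y \<open>finite J\<close> P_nonzero by (auto simp: J_def c_def)
    finally have "ip s (?q y) = ip p (?q y)" .
    moreover have "(\<lambda>z. (-1) * s z) \<in> polys"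
      using sV unfolding polys_def by (rule fun_scale_in_span)
    ultimately show ?thesis
      unfolding r_def using ip_add[OF pV _ JV[OF y], of "\<lambda>z. (-1) * s z"] ip_scale[OF sV JV[OF y], of "-1"]
      by simp
  qed
  have "ip r f = 0" if f: "f \<in> polys_degree_le n" and "n < m" for f n
  proof -
    \<comment> \<open>Orthogonality is demanded against every \<open>f\<close> of lower degree, not
      only the even ones: the even part \<open>e\<close> is covered by the induction hypothesis, the
      odd part \<open>h\<close> by parity.\<close>
    define e where "e = (\<lambda>z. (1/2) * (f z + f (reflect z)))"
    define h where "h = (\<lambda>z. (1/2) * (f z - f (reflect z)))"
    have e: "e \<in> polys_degree_le n"
      using f degree_le_reflect[OF f] unfolding e_def polys_degree_le_def
      by (intro fun_scale_in_span fun_add_in_span)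
    have h: "h \<in> polys_degree_le n"
      using f degree_le_reflect[OF f] unfolding h_def polys_degree_le_def
      by (intro fun_scale_in_span fun_diff_in_span)
    have V: "e \<in> polys" "h \<in> polys" using e h degree_le_polys by auto
    have rr: "reflect (reflect z) = z" for z by (simp add: reflect_def)
    have "e \<in> span (?q ` {(j, i). j \<le> n \<and> i \<le> j div 2})"
      by (rule less.IH[OF \<open>n < m\<close> e]) (simp add: e_def rr)
    then have "ip e r = 0"
    proof (rule orthogonal_span)
      show "?q ` {(j, i). j \<le> n \<and> i \<le> j div 2} \<subseteq> polys" using P_polys by auto
      show "ip a r = 0" if "a \<in> ?q ` {(j, i). j \<le> n \<and> i \<le> j div 2}" for a
        using that r_orth \<open>n < m\<close> unfolding ip_sym[of a] by (auto simp: J_def)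
    qed (rule rV)
    moreover have "h (reflect z) = - h z" for z
      by (simp only: h_def rr minus_diff_eq mult_minus_right[symmetric])
    then have "ip h r = 0"
      unfolding ip_sym[of h]
      by (intro weighted_inner_lifted_odd[OF rV V(2)] r_even)
    moreover have "f = (\<lambda>z. e z + h z)" by (auto simp: e_def h_def field_simps)
    ultimately show ?thesis
      using ip_add[OF V rV] by (simp add: ip_sym[of r])
  qed
  moreover have "\<forall>s t. r (s, t) = r (- s, t)"
    using r_even by (force simp: reflect_def)
  ultimately have "r \<in> even_orth_polys m (lifted_weight d W k) \<Omega>"
    using r_deg by (simp add: even_orth_polys_def orth_polys_def)
  then have "r \<in> span (P m ` {0..m div 2})"
    using basis[of m] by (simp add: orthogonal_basis_def)
  moreover have "P m ` {0..m div 2} \<subseteq> ?q ` {(j, i). j \<le> m \<and> i \<le> j div 2}" by force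
  ultimately have "r \<in> span (?q ` {(j, i). j \<le> m \<and> i \<le> j div 2})"
    using span_mono by blast
  moreover have "s \<in> span (?q ` {(j, i). j \<le> m \<and> i \<le> j div 2})"
  proof -
    have "?q ` J \<subseteq> ?q ` {(j, i). j \<le> m \<and> i \<le> j div 2}" by (rule image_mono) (auto simp: J_def)
    with s_span show ?thesis using span_mono by blast
  qed
  ultimately have "(\<lambda>z. r z + s z) \<in> span (?q ` {(j, i). j \<le> m \<and> i \<le> j div 2})"
    by (rule fun_add_in_span)
  then show ?case by (simp add: r_def)
qed

end

section \<open>Polynomials on the domain of revolution\<close>

lemma
  fixes \<beta> :: "'a::euclidean_space \<times> real \<Rightarrow> nat"
  shows monomial_prod: "monomial \<beta> (x, t) = monomial (\<lambda>b. \<beta> (b, 0)) x * t ^ \<beta> (0, 1)"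
    and sum_Basis_prod: "(\<Sum>u\<in>Basis. \<beta> u) = (\<Sum>b\<in>Basis. \<beta> (b, 0)) + \<beta> (0, 1)"
proof -
  have B: "(Basis :: ('a \<times> real) set) = (\<lambda>b. (b, 0)) ` Basis \<union> {(0, 1)}"
    by (auto simp: Basis_prod_def)
  have d: "(\<lambda>b. (b, 0)) ` Basis \<inter> {(0 :: 'a, 1 :: real)} = {}" by auto
  have inj: "inj_on (\<lambda>b. (b, 0 :: real)) (Basis :: 'a set)" by (auto simp: inj_on_def)
  show "monomial \<beta> (x, t) = monomial (\<lambda>b. \<beta> (b, 0)) x * t ^ \<beta> (0, 1)"
    unfolding monomial_def B by (subst prod.union_disjoint) (use d inj in \<open>auto simp: prod.reindex\<close>)
  show "(\<Sum>u\<in>Basis. \<beta> u) = (\<Sum>b\<in>Basis. \<beta> (b, 0)) + \<beta> (0, 1)"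
    unfolding B by (subst sum.union_disjoint) (use d inj in \<open>auto simp: sum.reindex\<close>)
qed

lemma degree_le_lift_fst:
  fixes f :: "'a::euclidean_space \<Rightarrow> real"
  assumes "f \<in> polys_degree_le m"
  shows "(\<lambda>z::'a \<times> real. f (fst z)) \<in> polys_degree_le m"
  using assms unfolding polys_degree_le_def
proof (induction rule: fun_span_induct)
  case (base f)
  then obtain \<alpha> where \<alpha>: "f = monomial \<alpha>" "(\<Sum>b\<in>Basis. \<alpha> b) \<le> m" by auto
  define \<beta> :: "'a \<times> real \<Rightarrow> nat" where "\<beta> u = (if snd u = 0 then \<alpha> (fst u) else 0)" for u
  have "(\<lambda>z. f (fst z)) = monomial \<beta>"
    by (auto simp: fun_eq_iff monomial_prod \<beta>_def \<alpha>)
  moreover have "(\<Sum>u\<in>Basis. \<beta> u) \<le> m"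
    unfolding sum_Basis_prod using \<alpha> by (simp add: \<beta>_def)
  ultimately show ?case by (auto intro: span_base)
qed (auto intro: fun_zero_in_span fun_add_in_span fun_scale_in_span)

lemma snd_power_degree_le: "(\<lambda>z::'a::euclidean_space \<times> real. snd z ^ e) \<in> polys_degree_le e"
proof -
  define \<beta> :: "'a \<times> real \<Rightarrow> nat" where "\<beta> u = (if snd u = 0 then 0 else e)" for u
  have "monomial (\<lambda>b. 0) x = 1" for x :: 'a by (simp add: monomial_def)
  then have "(\<lambda>z. snd z ^ e) = monomial \<beta>"
    by (auto simp: fun_eq_iff monomial_prod \<beta>_def)
  moreover have "(\<Sum>u\<in>Basis. \<beta> u) \<le> e"
    unfolding sum_Basis_prod by (simp add: \<beta>_def)
  ultimately show ?thesis by (simp add: monomial_degree_le)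
qed

abbreviation radial :: "'a::real_normed_vector \<times> real \<Rightarrow> real \<times> real" where
  "radial z \<equiv> (norm (fst z), snd z)"

text \<open>Evenness of \<open>p\<close> is not inherited by the terms of an expansion, so the
  induction runs over the symmetrised function. There the monomials odd in the first variable
  cancel, and even powers of the norm are polynomials; for even \<open>p\<close> symmetrisation
  changes nothing.\<close>

lemma even_degree_le_radial:
  fixes p :: "real \<times> real \<Rightarrow> real"
  assumes p: "p \<in> polys_degree_le m" and even: "\<And>z. p (reflect z) = p z"
  shows "(\<lambda>z::'a::euclidean_space \<times> real. p (radial z)) \<in> polys_degree_le m"
proof -
  have "(\<lambda>z::'a \<times> real. (1/2) * (p (radial z) + p (reflect (radial z)))) \<in> polys_degree_le m"
    using p unfolding polys_degree_le_def[of m]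
  proof (induction rule: fun_span_induct)
    case (base f)
    then obtain \<alpha> where \<alpha>: "f = monomial \<alpha>" "(\<Sum>b\<in>Basis. \<alpha> b) \<le> m" by auto
    show ?case
    proof (cases "even (\<alpha> (1, 0))")
      case True
      then obtain i where i: "\<alpha> (1, 0) = 2 * i" by (elim evenE)
      have "(\<lambda>z::'a \<times> real. norm (fst z) ^ (2 * i) * snd z ^ \<alpha> (0, 1)) \<in> polys_degree_le (2 * i + \<alpha> (0, 1))"
        using norm_power_homogeneous homogeneous_degree_le
        by (intro degree_le_mult degree_le_lift_fst snd_power_degree_le) blast
      moreover have "2 * i + \<alpha> (0, 1) \<le> m" using \<alpha> i by (simp add: sum_Basis_plane)
      ultimately have "(\<lambda>z::'a \<times> real. norm (fst z) ^ (2 * i) * snd z ^ \<alpha> (0, 1)) \<in> polys_degree_le m"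
        using degree_le_mono by blast
      moreover have "(\<lambda>z::'a \<times> real. (1/2) * (f (radial z) + f (reflect (radial z)))) =
          (\<lambda>z. norm (fst z) ^ (2 * i) * snd z ^ \<alpha> (0, 1))"
        by (auto simp: \<alpha> monomial_plane reflect_def i)
      ultimately show ?thesis by (simp only: polys_degree_le_def)
    next
      case False
      then show ?thesis
        by (simp add: \<alpha> monomial_plane reflect_def fun_zero_in_span)
    qed
  next
    case (add f g)
    from fun_add_in_span[OF add(3,4)] show ?case by (simp add: algebra_simps add_divide_distrib)
  next
    case (scale c f)
    from fun_scale_in_span[OF scale(2), of c] show ?case by (simp add: algebra_simps)
  qed (auto intro: fun_zero_in_span)
  then show ?thesis by (simp add: even)
qed

section \<open>Integration over the domain of revolution\<close>

context even_weighted_domain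
begin

lemma revolution_indicator:
  "indicator (revolution_domain \<Omega>) z * revolution_weight W z = wt (radial z)" for z :: "(real ^ 'd) \<times> real"
  by (cases z) (auto simp: revolution_domain_def revolution_weight_def right_half_def wt_def indicator_def)

lemma weighted_inner_revolution:
  fixes f g :: "(real ^ 'd) \<times> real \<Rightarrow> real"
  shows "weighted_inner (revolution_weight W) (revolution_domain \<Omega>) f g =
    (\<integral>z. f z * g z * wt (radial z) \<partial>lebesgue)"
  unfolding weighted_inner_def set_integral_indicator
  by (simp add: mult_ac flip: revolution_indicator)

text \<open>By homogeneity \<open>Y\<close> contributes \<open>norm x ^ m\<close> to the radial
  factor and its values on the unit sphere to the other. Integrability is part of the conclusion and
  is what \<open>revolution_poly_integrable\<close> draws on.\<close>

lemma revolution_integral: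
  fixes Y :: "real ^ 'd \<Rightarrow> real"
  assumes p: "p \<in> polys" and Y: "Y \<in> homogeneous_polys m"
  shows "has_bochner_integral lebesgue (\<lambda>z. p (radial z) * Y (fst z) * wt (radial z))
    ((\<integral>u. radial_density CARD('d) (fst u) * (fst u ^ m * p u * wt u) \<partial>lebesgue) * integral\<^sup>L surface_measure Y)"
proof -
  have "continuous_on UNIV Y"
    using Y homogeneous_degree_le continuous_on_degree_le by blast
  then have g: "integrable surface_measure Y" by (rule integrable_surface_measure)
  have "integrable lebesgue (\<lambda>u. (radial_density CARD('d) (fst u) * fst u ^ m) * p u * wt u)"
  proof (rule integrable_poly_wt[OF _ _ p])
    show "(\<lambda>u::real \<times> real. radial_density CARD('d) (fst u) * fst u ^ m) \<in> borel_measurable borel"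
      by (intro borel_measurable_times radial_density_fst_measurable
          borel_measurable_continuous_onI continuous_intros)
    show "\<bar>radial_density CARD('d) (fst u) * fst u ^ m\<bar> \<le> \<bar>fst u\<bar> ^ (CARD('d) - 1 + m)" for u :: "real \<times> real"
      unfolding power_add by (simp add: radial_density_def abs_mult power_abs)
  qed
  then have F: "integrable lebesgue (\<lambda>u. radial_density DIM(real ^ 'd) (fst u) * (fst u ^ m * p u * wt u))"
    by (simp add: mult.assoc)
  have e: "(\<lambda>z::(real ^ 'd) \<times> real. p (radial z) * Y (fst z) * wt (radial z)) =
      (\<lambda>z. (norm (fst z) ^ m * p (radial z) * wt (radial z)) * Y (sgn (fst z)))"
    by (rule ext) (subst homogeneous_radial[OF Y], simp)
  show ?thesis
    unfolding e using cylindrical_integral[OF F g] by simp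
qed

text \<open>The power \<open>2 * k\<close> from \<open>Y\<close> joins the radial density to form
  the lifted weight of index \<open>2 * k\<close>. The integrand is then even in the first variable,
  so the right half plane carries half of the integral: the origin of the factor \<open>1/2\<close>
  in the norm formula.\<close>

lemma revolution_integral_even:
  fixes Y :: "real ^ 'd \<Rightarrow> real"
  assumes p: "p \<in> polys" "\<And>z. p (reflect z) = p z" and Y: "Y \<in> homogeneous_polys (2 * k)"
  shows "(\<integral>z. p (radial z) * Y (fst z) * wt (radial z) \<partial>lebesgue) =
    (\<integral>u. \<bar>fst u\<bar> ^ (2 * k + CARD('d) - 1) * p u * wt u \<partial>lebesgue) / 2 * integral\<^sup>L surface_measure Y"
proof -
  have c: "0 < CARD('d)" by simp
  have "radial_density CARD('d) s * s ^ (2 * k) = \<bar>s\<bar> ^ (2 * k + CARD('d) - 1) * indicator {0..} s" for s :: real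
  proof -
    \<comment> \<open>Subtraction is truncated, so this regrouping rests on the positive
      dimension.\<close>
    have "2 * k + CARD('d) - 1 = CARD('d) - 1 + 2 * k" using c by linarith
    then show ?thesis by (simp only: power_add) (simp add: radial_density_def indicator_def)
  qed
  note rd = this
  have "radial_density CARD('d) (fst u) * (fst u ^ (2 * k) * p u * wt u) =
      (\<bar>fst u\<bar> ^ (2 * k + CARD('d) - 1) * p u * wt u) * indicator {0..} (fst u)" for u
  proof -
    have "radial_density CARD('d) (fst u) * (fst u ^ (2 * k) * p u * wt u) =
        (radial_density CARD('d) (fst u) * fst u ^ (2 * k)) * (p u * wt u)"
      by (simp only: mult.assoc)
    then show ?thesis unfolding rd by (simp only: mult_ac)
  qed
  then have "(\<integral>u. radial_density CARD('d) (fst u) * (fst u ^ (2 * k) * p u * wt u) \<partial>lebesgue) =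
      (\<integral>u. (\<bar>fst u\<bar> ^ (2 * k + CARD('d) - 1) * p u * wt u) * indicator {0..} (fst u) \<partial>lebesgue)"
    by presburger
  also have "\<dots> = (\<integral>u. \<bar>fst u\<bar> ^ (2 * k + CARD('d) - 1) * p u * wt u \<partial>lebesgue) / 2"
    by (rule integral_even[OF integrable_abs_power_poly[OF p(1)]])
       (simp add: wt_reflect p(2), simp add: reflect_def)
  finally show ?thesis
    using revolution_integral[OF p(1) Y] by (simp add: has_bochner_integral_iff)
qed

text \<open>A monomial is a power of \<open>t\<close> times a monomial in \<open>x\<close>; the
  latter is homogeneous, though not harmonic in general, and \<open>revolution_integral\<close> asks
  for no more.\<close>

lemma revolution_poly_integrable:
  fixes q :: "(real ^ 'd) \<times> real \<Rightarrow> real"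
  assumes "q \<in> polys"
  shows "set_integrable lebesgue (revolution_domain \<Omega>) (\<lambda>z. q z * revolution_weight W z)"
proof -
  have "integrable lebesgue (\<lambda>z. q z * wt (radial z))"
    using assms unfolding polys_def
  proof (induction rule: fun_span_induct)
    case (base f)
    then obtain \<beta> where f: "f = monomial \<beta>" by auto
    define \<alpha> where "\<alpha> = (\<lambda>b. \<beta> (b, 0))"
    have "(\<lambda>z::real \<times> real. fst z ^ 0 * snd z ^ \<beta> (0, 1)) \<in> polys"
      using power_plane_degree_le[of 0 "\<beta> (0, 1)"] degree_le_polys by blast
    from revolution_integral[OF this monomial_homogeneous[of \<alpha>]]
    have "integrable lebesgue (\<lambda>z::(real ^ 'd) \<times> real. snd z ^ \<beta> (0, 1) * monomial \<alpha> (fst z) * wt (radial z))"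
      by (simp add: has_bochner_integral_iff)
    also have "(\<lambda>z::(real ^ 'd) \<times> real. snd z ^ \<beta> (0, 1) * monomial \<alpha> (fst z) * wt (radial z)) = (\<lambda>z. f z * wt (radial z))"
      by (auto simp: fun_eq_iff f monomial_prod \<alpha>_def)
    finally show ?case .
  next
    case (add f g)
    from Bochner_Integration.integrable_add[OF add(3,4)] show ?case by (simp add: algebra_simps)
  next
    case (scale c f)
    from integrable_mult_right[OF scale(2), of c] show ?case by (simp add: algebra_simps)
  qed simp
  then show ?thesis
    by (simp add: set_integrable_def mult_ac flip: revolution_indicator)
qed

end

section \<open>The orthogonal basis on the domain of revolution\<close>

locale revolution_basis = even_weighted_domain \<Omega> W for \<Omega> W +
  fixes P :: "nat \<Rightarrow> nat \<Rightarrow> nat \<Rightarrow> real \<times> real \<Rightarrow> real"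
    and Y :: "nat \<Rightarrow> nat \<Rightarrow> real ^ 'd \<Rightarrow> real" and N :: "nat \<Rightarrow> nat"
  assumes P_basis: "\<And>k m. orthogonal_basis
            (weighted_inner (lifted_weight CARD('d) W (2 * k)) \<Omega>)
            (even_orth_polys m (lifted_weight CARD('d) W (2 * k)) \<Omega>)
            {0..m div 2} (P k m)"
    and Y_basis: "\<And>k. orthonormal_basis sphere_inner (harmonics k)
            {1..N k} (Y k)"
begin

sublocale P: even_orthogonal_basis \<Omega> W "CARD('d)" "2 * k" "P k" for k
  by unfold_locales (rule P_basis)

abbreviation rip :: "((real ^ 'd) \<times> real \<Rightarrow> real) \<Rightarrow> ((real ^ 'd) \<times> real \<Rightarrow> real) \<Rightarrow> real" where
  "rip \<equiv> weighted_inner (revolution_weight W) (revolution_domain \<Omega>)"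

sublocale symmetric_bilinear rip polys
  by (rule symmetric_bilinear_weighted_inner[OF revolution_poly_integrable])



text \<open>The radial degree \<open>m\<close> is an index of its own, whereas in
  \<open>revolution_poly\<close> it is tied to \<open>n - k\<close>; products of all total degrees
  \<open>m + k\<close> then form one orthogonal family.\<close>

definition R :: "nat \<times> nat \<times> nat \<times> nat \<Rightarrow> (real ^ 'd) \<times> real \<Rightarrow> real" where
  "R = (\<lambda>(m, k, j, l) z. P k m j (radial z) * Y k l (fst z))"

definition index_le :: "nat \<Rightarrow> (nat \<times> nat \<times> nat \<times> nat) set" where
  "index_le n = {(m, k, j, l). m + k \<le> n \<and> j \<le> m div 2 \<and> 1 \<le> l \<and> l \<le> N k}"

lemma finite_index_le: "finite (index_le n)"
proof -
  have "index_le n \<subseteq> {..n} \<times> {..n} \<times> {..n} \<times> (\<Union>k\<le>n. {..N k})"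
    unfolding index_le_def by force
  then show ?thesis by (rule finite_subset) auto
qed

lemma Y_harmonic: "1 \<le> l \<Longrightarrow> l \<le> N k \<Longrightarrow> Y k l \<in> harmonics k"
  using Y_basis[of k] orthogonal_basis_memberD[of sphere_inner "harmonics k" "{1..N k}" "Y k" l]
  by (simp add: orthonormal_basis_def)

lemma Y_homogeneous: "1 \<le> l \<Longrightarrow> l \<le> N k \<Longrightarrow> Y k l \<in> homogeneous_polys k"
  using Y_harmonic by (auto simp: harmonics_def)

lemma surface_Y:
  assumes "1 \<le> l" "l \<le> N k" "1 \<le> l'" "l' \<le> N k'"
  shows "(\<integral>\<xi>. Y k l \<xi> * Y k' l' \<xi> \<partial>surface_measure) =
    (if (k, l) = (k', l') then sphere_area TYPE(real ^ 'd) else 0)"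
proof (cases "k = k'")
  case True
  have c: "continuous_on UNIV (Y k l)" if "1 \<le> l" "l \<le> N k" for k l
    using Y_homogeneous[OF that] homogeneous_degree_le continuous_on_degree_le by blast
  have "sphere_inner (Y k l) (Y k l') = (if l = l' then 1 else 0)"
    using Y_basis[of k] assms True by (auto simp: orthonormal_basis_def orthogonal_basis_def)
  then show ?thesis
    using True sphere_inner_surface[OF c c] assms by simp
next
  case False
  with surface_harmonics_orthogonal[OF Y_harmonic Y_harmonic] assms show ?thesis by simp
qed

lemma R_degree:
  assumes "j \<le> m div 2" "1 \<le> l" "l \<le> N k"
  shows "R (m, k, j, l) \<in> polys_degree_le (m + k)"
  unfolding R_def prod.case
  using even_degree_le_radial[OF P.P_degree P.P_even, OF assms(1) assms(1)] Y_homogeneous[OF assms(2,3)]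
    homogeneous_degree_le
  by (intro degree_le_mult degree_le_lift_fst) blast+

text \<open>If \<open>(k, l)\<close> and \<open>(k', l')\<close> differ, the sphere factor vanishes;
  this is essential for different \<open>k\<close>, where the radial parts belong to different
  weights. For equal pairs both radial parts meet the same lifted weight, even when \<open>m\<close>
  and \<open>m'\<close> differ.\<close>

lemma R_inner:
  assumes "j \<le> m div 2" "1 \<le> l" "l \<le> N k" "j' \<le> m' div 2" "1 \<le> l'" "l' \<le> N k'"
  shows "rip (R (m, k, j, l)) (R (m', k', j', l')) =
    (if (k, l) = (k', l') then sphere_area TYPE(real ^ 'd) / 2 *
       weighted_inner (lifted_weight CARD('d) W (2 * k)) \<Omega> (P k m j) (P k m' j') else 0)"
proof -
  have PP: "(\<lambda>u. P k m j u * P k' m' j' u) \<in> polys"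
    using assms by (intro polys_mult P.P_polys)
  have YY: "(\<lambda>x. Y k l x * Y k' l' x) \<in> homogeneous_polys (k + k')"
    using assms by (intro homogeneous_mult Y_homogeneous)
  have e: "rip (R (m, k, j, l)) (R (m', k', j', l')) =
     (\<integral>z. (P k m j (radial z) * P k' m' j' (radial z)) * (Y k l (fst z) * Y k' l' (fst z)) * wt (radial z) \<partial>lebesgue)"
    unfolding weighted_inner_revolution by (simp add: R_def mult_ac)
  show ?thesis
  proof (cases "(k, l) = (k', l')")
    case False
    then show ?thesis
      using revolution_integral[OF PP YY] surface_Y[OF assms(2,3,5,6)]
      unfolding e by (auto simp: has_bochner_integral_iff)
  next
    case True
    have YY': "(\<lambda>x. Y k l x * Y k' l' x) \<in> homogeneous_polys (2 * k)"
      using YY True by (simp add: mult_2)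
    show ?thesis
      unfolding e using True assms surface_Y[OF assms(2,3,5,6)]
      by (subst revolution_integral_even[OF PP _ YY'])
         (auto simp: P.P_even weighted_inner_lifted)
  qed
qed

lemma R_orthogonal:
  assumes "x \<in> index_le n" "y \<in> index_le n'" "x \<noteq> y"
  shows "rip (R x) (R y) = 0"
proof -
  obtain m k j l m' k' j' l' where xy: "x = (m, k, j, l)" "y = (m', k', j', l')"
    by (metis prod.exhaust)
  show ?thesis
    using assms P.P_orthogonal[of j m j' m' k] unfolding xy
    by (subst R_inner) (auto simp: index_le_def)
qed

lemma R_nonzero:
  assumes "x \<in> index_le n"
  shows "rip (R x) (R x) \<noteq> 0"
proof -
  obtain m k j l where x: "x = (m, k, j, l)"
    by (metis prod.exhaust)
  show ?thesis
    using assms P.P_nonzero[of j m k] sphere_area_pos[where ?'a = "real ^ 'd"] unfolding x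
    by (subst R_inner) (auto simp: index_le_def)
qed

text \<open>The system in which the radial factor is expanded depends on the degree \<open>k\<close>
  of \<open>Z\<close>, so a harmonic factor has to be split off before the expansion.\<close>

lemma harmonic_times_even_in_span:
  assumes p: "p \<in> polys_degree_le m" "\<And>z. p (reflect z) = p z" and Z: "Z \<in> harmonics k" and "m + k \<le> n"
  shows "(\<lambda>z. p (radial z) * Z (fst z)) \<in> span (R ` index_le n)"
proof (rule span_mult)
  let ?A = "(\<lambda>(j, i). P k j i) ` {(j, i). j \<le> m \<and> i \<le> j div 2}" and ?B = "Y k ` {1..N k}"
  show "(\<lambda>z. p (radial z)) \<in> span ((\<lambda>g z. g (radial z)) ` ?A)"
    by (rule span_compose[OF P.even_poly_in_span[OF p]])
  have "Z \<in> span ?B"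
    using Y_basis[of k] Z by (simp add: orthonormal_basis_def orthogonal_basis_def)
  then show "(\<lambda>z. Z (fst z)) \<in> span ((\<lambda>g z. g (fst z)) ` ?B)"
    by (rule span_compose)
  show "(\<lambda>z. a z * b z) \<in> span (R ` index_le n)"
    if ab: "a \<in> (\<lambda>g z. g (radial z)) ` ?A" "b \<in> (\<lambda>g z. g (fst z)) ` ?B" for a b
  proof -
    obtain j i l where "j \<le> m" "i \<le> j div 2" "1 \<le> l" "l \<le> N k"
      "a = (\<lambda>z. P k j i (radial z))" "b = (\<lambda>z. Y k l (fst z))" using ab by auto
    moreover from this have "(\<lambda>z. a z * b z) = R (j, k, i, l)" by (simp add: R_def)
    ultimately show ?thesis
      using \<open>m + k \<le> n\<close> by (auto simp: index_le_def intro!: span_base)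
  qed
qed

lemma polys_in_span:
  assumes "f \<in> polys_degree_le n"
  shows "f \<in> span (R ` index_le n)"
proof -
  have "monomial \<beta> \<in> span (R ` index_le n)" if \<beta>: "(\<Sum>b\<in>Basis. \<beta> b) \<le> n" for \<beta>
  proof -
    define \<alpha> where "\<alpha> = (\<lambda>b. \<beta> (b, 0))"
    define a where "a = (\<Sum>b\<in>Basis. \<alpha> b)"
    obtain Z where "\<forall>i\<in>{0..a div 2}. Z i \<in> harmonics (a - 2 * i)"
      and "\<forall>x. monomial \<alpha> x = (\<Sum>i=0..a div 2. (norm x) ^ (2 * i) * Z i x)"
      using harmonic_decomposition[OF monomial_homogeneous[of \<alpha>]] unfolding a_def by blast
    note Z = this(1)[rule_format] and \<alpha> = this(2)[rule_format]
    let ?p = "\<lambda>i z. fst z ^ (2 * i) * snd z ^ \<beta> (0, 1) :: real"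
    have "monomial \<beta> = (\<lambda>z. \<Sum>i=0..a div 2. ?p i (radial z) * Z i (fst z))"
    proof
      fix z :: "(real ^ 'd) \<times> real"
      have "monomial \<beta> z = monomial \<alpha> (fst z) * snd z ^ \<beta> (0, 1)"
        by (cases z) (simp add: monomial_prod \<alpha>_def)
      also have "\<dots> = (\<Sum>i=0..a div 2. norm (fst z) ^ (2 * i) * Z i (fst z) * snd z ^ \<beta> (0, 1))"
        unfolding \<alpha> by (rule sum_distrib_right)
      finally show "monomial \<beta> z = (\<Sum>i=0..a div 2. ?p i (radial z) * Z i (fst z))"
        by (simp add: mult_ac)
    qed
    also have "\<dots> \<in> span (R ` index_le n)"
    proof (rule fun_sum_in_span, rule harmonic_times_even_in_span)
      fix i assume i: "i \<in> {0..a div 2}"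
      show "?p i \<in> polys_degree_le (2 * i + \<beta> (0, 1))"
        by (rule power_plane_degree_le) simp
      show "?p i (reflect z) = ?p i z" for z by (simp add: reflect_def)
      show "Z i \<in> harmonics (a - 2 * i)" by (rule Z[OF i])
      \<comment> \<open>The power of the norm gains the degree that the harmonic factor loses; the
        total is always \<open>a + \<beta> (0, 1)\<close>.\<close>
      show "2 * i + \<beta> (0, 1) + (a - 2 * i) \<le> n"
        using \<beta> i by (simp add: sum_Basis_prod a_def \<alpha>_def)
    qed
    finally show ?thesis .
  qed
  then have "polys_degree_le n \<subseteq> span (R ` index_le n)"
    unfolding polys_degree_le_def by (intro span_minimal) auto
  with assms show ?thesis by blast
qed

lemma R_polys: "x \<in> index_le n \<Longrightarrow> R x \<in> polys"
  using R_degree degree_le_polys unfolding index_le_def by blast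

section \<open>The products of exact degree \<open>n\<close>\<close>

definition index_eq :: "nat \<Rightarrow> (nat \<times> nat \<times> nat) set" where
  "index_eq n = {(j, k, l). 1 \<le> l \<and> l \<le> N k \<and> j \<le> (n - k) div 2 \<and> k \<le> n}"

abbreviation lift_index :: "nat \<Rightarrow> nat \<times> nat \<times> nat \<Rightarrow> nat \<times> nat \<times> nat \<times> nat" where
  "lift_index n \<equiv> \<lambda>(j, k, l). (n - k, k, j, l)"

lemma revolution_poly_R: "revolution_poly P Y n x = R (lift_index n x)"
  by (auto simp: revolution_poly_def R_def case_prod_unfold fun_eq_iff)

lemma lift_index_mem: "x \<in> index_eq n \<Longrightarrow> lift_index n x \<in> index_le n"
  by (auto simp: index_eq_def index_le_def)

lemma finite_index_eq: "finite (index_eq n)"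
proof -
  have "inj_on (lift_index n) (index_eq n)" by (auto simp: inj_on_def)
  moreover have "lift_index n ` index_eq n \<subseteq> index_le n" using lift_index_mem by blast
  ultimately show ?thesis using finite_index_le inj_on_finite by blast
qed

lemma lift_index_inj: "x \<noteq> y \<Longrightarrow> lift_index n x \<noteq> lift_index n y"
  by (cases x; cases y) auto

abbreviation orth :: "nat \<Rightarrow> ((real ^ 'd) \<times> real \<Rightarrow> real) set" where
  "orth n \<equiv> orth_polys n (revolution_weight W) (revolution_domain \<Omega>)"

lemma subspace_orth: "subspace (orth n)"
proof (rule fun_subspaceI)
  have V: "f \<in> polys" if "f \<in> polys_degree_le m" for f :: "(real ^ 'd) \<times> real \<Rightarrow> real" and m
    using that degree_le_polys by blast
  have deg: "(\<lambda>x. 0) \<in> (polys_degree_le n :: ((real ^ 'd) \<times> real \<Rightarrow> real) set)"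
    "f \<in> polys_degree_le n \<Longrightarrow> g \<in> polys_degree_le n \<Longrightarrow> (\<lambda>x. f x + g x) \<in> polys_degree_le n"
    "f \<in> polys_degree_le n \<Longrightarrow> (\<lambda>x. c * f x) \<in> polys_degree_le n"
    for f g :: "(real ^ 'd) \<times> real \<Rightarrow> real" and c
    unfolding polys_degree_le_def by (rule fun_zero_in_span fun_add_in_span fun_scale_in_span; assumption?)+
  show "(\<lambda>x. 0) \<in> orth n"
    unfolding orth_polys_def using deg(1) ip_zero V by blast
  show "(\<lambda>x. f x + g x) \<in> orth n" if "f \<in> orth n" "g \<in> orth n" for f g
    using that deg(2)[of f g] unfolding orth_polys_def by (auto simp: ip_add[OF V V V])
  show "(\<lambda>x. c * f x) \<in> orth n" if "f \<in> orth n" for f c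
    using that deg(3)[of f c] unfolding orth_polys_def by (auto simp: ip_scale[OF V V])
qed

text \<open>A polynomial of degree \<open>m < n\<close> lies in the span of the products indexed by
  \<open>index_le m\<close>, and the index of a product of total degree \<open>n\<close> is not
  among these.\<close>

lemma revolution_poly_orth:
  assumes x: "x \<in> index_eq n"
  shows "revolution_poly P Y n x \<in> orth n"
proof -
  have d: "R (lift_index n x) \<in> polys_degree_le n"
    using R_degree[of "fst x" "n - fst (snd x)" "snd (snd x)" "fst (snd x)"] x
    by (auto simp: index_eq_def)
  have "rip (R (lift_index n x)) f = 0" if "m < n" "f \<in> polys_degree_le m" for m f
  proof -
    have "rip f (R (lift_index n x)) = 0"
    proof (rule orthogonal_span[OF polys_in_span[OF that(2)]])
      show "R ` index_le m \<subseteq> polys" using R_polys by blast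
      show "R (lift_index n x) \<in> polys" using d degree_le_polys by blast
      show "rip a (R (lift_index n x)) = 0" if a: "a \<in> R ` index_le m" for a
      proof -
        obtain y where y: "a = R y" "y \<in> index_le m" using a by blast
        with x \<open>m < n\<close> have "y \<noteq> lift_index n x"
          by (auto simp: index_le_def index_eq_def)
        with y lift_index_mem[OF x] R_orthogonal show ?thesis by blast
      qed
    qed
    then show ?thesis by (simp add: ip_sym[of "R _"])
  qed
  with d show ?thesis by (simp add: orth_polys_def revolution_poly_R)
qed

lemma orth_in_span:
  assumes f: "f \<in> orth n"
  shows "f \<in> span (revolution_poly P Y n ` index_eq n)"
proof -
  have "f \<in> polys_degree_le n" using f by (simp add: orth_polys_def)
  then have "f = (\<lambda>z. \<Sum>x\<in>index_le n. rip f (R x) / rip (R x) (R x) * R x z)"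
    using R_polys R_orthogonal R_nonzero
    by (intro orthogonal_expansion finite_index_le polys_in_span) auto
  also have "\<dots> \<in> span (revolution_poly P Y n ` index_eq n)"
  proof (rule fun_sum_in_span)
    fix x assume x: "x \<in> index_le n"
    obtain m k j l where xx: "x = (m, k, j, l)" by (metis prod.exhaust)
    show "(\<lambda>z. rip f (R x) / rip (R x) (R x) * R x z) \<in> span (revolution_poly P Y n ` index_eq n)"
    proof (cases "m + k = n")
      case True
      then have "R x = revolution_poly P Y n (j, k, l)" "(j, k, l) \<in> index_eq n"
        using x xx by (auto simp: revolution_poly_R index_le_def index_eq_def)
      then have "R x \<in> span (revolution_poly P Y n ` index_eq n)" by (auto intro: span_base)
      then show ?thesis by (rule fun_scale_in_span)
    next
      case False
      with x xx have "m + k < n" "R x \<in> polys_degree_le (m + k)"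
        using R_degree by (auto simp: index_le_def)
      then have "rip f (R x) = 0" using f by (auto simp: orth_polys_def)
      then show ?thesis by (simp add: fun_zero_in_span)
    qed
  qed
  finally show ?thesis .
qed

lemma revolution_orthogonal_basis:
  "orthogonal_basis rip (orth n) (index_eq n) (revolution_poly P Y n)"
proof -
  let ?Q = "revolution_poly P Y n"
  have V: "?Q x \<in> polys" if "x \<in> index_eq n" for x
    using R_polys[OF lift_index_mem[OF that]] by (simp add: revolution_poly_R)
  have orthogonal: "rip (?Q x) (?Q y) = 0" if "x \<in> index_eq n" "y \<in> index_eq n" "x \<noteq> y" for x y
    unfolding revolution_poly_R using that
    by (intro R_orthogonal[OF lift_index_mem lift_index_mem] lift_index_inj)
  have nz: "rip (?Q x) (?Q x) \<noteq> 0" if "x \<in> index_eq n" for x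
    using R_nonzero[OF lift_index_mem[OF that]] by (simp add: revolution_poly_R)
  have "span (?Q ` index_eq n) = orth n"
  proof
    show "span (?Q ` index_eq n) \<subseteq> orth n"
      using revolution_poly_orth subspace_orth by (intro span_minimal) auto
    show "orth n \<subseteq> span (?Q ` index_eq n)"
      using orth_in_span by blast
  qed
  moreover have "inj_on ?Q (index_eq n)" "independent (?Q ` index_eq n)"
    using V orthogonal nz by (intro orthogonal_inj_independent finite_index_eq; blast)+
  ultimately show ?thesis
    using orthogonal by (simp add: orthogonal_basis_def)
qed

lemma revolution_norm:
  assumes "(j, k, l) \<in> index_eq n"
  shows "rip (revolution_poly P Y n (j, k, l)) (revolution_poly P Y n (j, k, l)) =
    sphere_area TYPE(real ^ 'd) / 2 *
      weighted_inner (lifted_weight CARD('d) W (2 * k)) \<Omega> (P k (n - k) j) (P k (n - k) j)"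
  using assms R_inner[of j "n - k" l k j "n - k" l k]
  by (simp add: revolution_poly_R index_eq_def)

end

theorem theorem3p1:
  fixes \<Omega> :: "(real \<times> real) set"
    and W :: "real \<times> real \<Rightarrow> real"
    and P :: "nat \<Rightarrow> nat \<Rightarrow> nat \<Rightarrow> real \<times> real \<Rightarrow> real"
    and Y :: "nat \<Rightarrow> nat \<Rightarrow> real ^ 'd \<Rightarrow> real"
    and n :: nat
  assumes "\<Omega> \<in> sets lebesgue"
    and "\<And>s t. (s, t) \<in> \<Omega> \<longleftrightarrow> (- s, t) \<in> \<Omega>"
    and "even_weight W \<Omega>"
    and "\<And>k m. orthogonal_basis
            (weighted_inner (lifted_weight CARD('d) W (2 * k)) \<Omega>)
            (even_orth_polys m (lifted_weight CARD('d) W (2 * k)) \<Omega>)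
            {0..m div 2} (P k m)"
    and "\<And>k. orthonormal_basis sphere_inner (harmonics k)
            {1..dim (harmonics k :: (real ^ 'd \<Rightarrow> real) set)} (Y k)"
  defines "I \<equiv> {(j, k, l). 1 \<le> l \<and> l \<le> dim (harmonics k :: (real ^ 'd \<Rightarrow> real) set) \<and>
                  j \<le> (n - k) div 2 \<and> k \<le> n}"
  shows "orthogonal_basis
           (weighted_inner (revolution_weight W) (revolution_domain \<Omega>))
           (orth_polys n (revolution_weight W) (revolution_domain \<Omega>))
           I (revolution_poly P Y n) \<and>
         (\<forall>(j, k, l)\<in>I.
           weighted_inner (revolution_weight W) (revolution_domain \<Omega>)
             (revolution_poly P Y n (j, k, l)) (revolution_poly P Y n (j, k, l)) =
           sphere_area TYPE(real ^ 'd) / 2 *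
           weighted_inner (lifted_weight CARD('d) W (2 * k)) \<Omega> (P k (n - k) j) (P k (n - k) j))"
proof -
  interpret revolution_basis \<Omega> W P Y "\<lambda>k. dim (harmonics k :: (real ^ 'd \<Rightarrow> real) set)"
    using assms(1-5) by unfold_locales auto
  have "I = index_eq n" by (simp add: assms(6) index_eq_def)
  then show ?thesis
    using revolution_orthogonal_basis[of n] revolution_norm by auto
qed

end
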